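(* Let $s\ge 1$ and $c_1,\dots,c_s\ge 1$ be integers, and let $\{A_i \mid 1\le i\le n\}$ be a family of groups whose abelianizations have mutually coprime orders. If $\prod_{i=1}^n A_i$ is nilpotent of class at most $c_1$, then $\prod_{i=1}^n A_i$ is $\mathcal{N}_{c_1,\dots,c_s}$-capable if and only if every $A_i$ is $\mathcal{N}_{c_1,\dots,c_s}$-capable.
   Context: The phrase "mutually coprime orders" means that the abelianizations $A_i^{ab}=A_i/A_i'$ are finite and $\gcd(|A_i^{ab}|,|A_j^{ab}|)=1$ for all $i\neq j$. $\mathcal{N}_{c_1,\dots,c_s}$ denotes the variety of polynilpotent groups of class row $(c_1,\dots,c_s)$, i.e. the variety whose verbal subgroup is $V(G)=\gamma_{c_s+1}(\gamma_{c_{s-1}+1}(\cdots\gamma_{c_1+1}(G)\cdots))$, where $\gamma_{k}$ denotes the $k$-th term of the lower central series ($\gamma_1(H)=H$). It is defined by the single outer commutator word obtained by substituting words on disjoint sets of variables: the word for $(c_1)$ is the left-normed commutator $[x_1,\dots,x_{c_1+1}]$, and the word for $(c_1,\dots,c_s)$ is obtained from $[y_1,\dots,y_{c_s+1}]$ by replacing each $y_j$ with a copy, in fresh variables, of the word for $(c_1,\dots,c_{s-1})$. For a variety $\mathcal{V}$ defined by a set of laws $V$ and a group $E$, the marginal subgroup is $$V^*(E)=\{a\in E : v(g_1,\dots,g_i a,\dots,g_m)=v(g_1,\dots,g_m)\ \text{for all } v\in V,\ \text{all } g_1,\dots,g_m\in E,\ \text{all } 1\le i\le m\}.$$ A group $G$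 is $\mathcal{V}$-capable if there is a group $E$ with $G\cong E/V^*(E)$. *)

theory Defs
  imports "HOL-Algebra.Algebra"
begin

section \<open>Group words and marginal subgroups\<close>

text \<open>Laws are group terms. Terms that are equal in the free group take the same value in every
  group, so nothing below depends on the choice of term representing a word.\<close>

datatype 'v gword = WVar 'v | WOne | WInv "'v gword" | WMult "'v gword" "'v gword"
  for map: wrename

primrec weval :: "('a, 'b) monoid_scheme \<Rightarrow> ('v \<Rightarrow> 'a) \<Rightarrow> 'v gword \<Rightarrow> 'a" where
  "weval G \<rho> (WVar x) = \<rho> x"
| "weval G \<rho> WOne = \<one>\<^bsub>G\<^esub>"
| "weval G \<rho> (WInv w) = inv\<^bsub>G\<^esub> (weval G \<rho> w)"
| "weval G \<rho> (WMult v w) = weval G \<rho> v \<otimes>\<^bsub>G\<^esub> weval G \<rho> w"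

text \<open>The tuple \<open>(g\<^sub>1, \<dots>, g\<^sub>m)\<close> is replaced by an assignment of all variables; changing the value
  of a variable that does not occur in the law is a vacuous condition.\<close>

definition marginal :: "'v gword set \<Rightarrow> ('a, 'b) monoid_scheme \<Rightarrow> 'a set" where
  "marginal V E = {a \<in> carrier E. \<forall>v \<in> V. \<forall>\<rho> \<in> UNIV \<rightarrow> carrier E. \<forall>i.
     weval E (\<rho>(i := \<rho> i \<otimes>\<^bsub>E\<^esub> a)) v = weval E \<rho> v}"

section \<open>Capability\<close>

text \<open>HOL cannot quantify over the type of the elements of \<open>E\<close>, so \<open>E\<close> is sought on the type of
  lists over the element type of \<open>G\<close>, whose cardinality is the maximum of that of the element type
  and \<open>\<aleph>\<^sub>0\<close>. By a downward Loewenheim-Skolem argument this loses nothing: lemma \<open>capableI\<close> below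
  shows that, for laws in countably many variables, a witness \<open>E\<close> on an arbitrary type suffices.\<close>

definition capable :: "'v gword set \<Rightarrow> ('a, 'b) monoid_scheme \<Rightarrow> bool" where
  "capable V G \<longleftrightarrow> (\<exists>E :: 'a list monoid. group E \<and> G \<cong> E Mod marginal V E)"

section \<open>Polynilpotent words\<close>

definition wcomm :: "'v gword \<Rightarrow> 'v gword \<Rightarrow> 'v gword" where
  "wcomm v w = WMult (WMult (WInv v) (WInv w)) (WMult v w)"

primrec lnwcomm :: "'v gword list \<Rightarrow> 'v gword" where
  "lnwcomm [] = WOne"
| "lnwcomm (w # ws) = foldl wcomm w ws"

text \<open>Variables are lists of numbers. Prefixing every variable with \<open>j\<close> produces the \<open>j\<close>-th copy
  of a word, and distinct copies have disjoint sets of variables. The fold starts with a single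
  variable (the empty class row) and treats \<open>c\<^sub>1\<close> first, i.e. innermost.\<close>

definition polynilpotent_word :: "nat list \<Rightarrow> nat list gword" where
  "polynilpotent_word cs =
     foldl (\<lambda>w c. lnwcomm (map (\<lambda>j. wrename (Cons j) w) [0..<Suc c])) (WVar []) cs"

section \<open>Nilpotency and abelianization\<close>

text \<open>\<open>lower_central G k\<close> is \<open>\<gamma>\<^bsub>k+1\<^esub>(G)\<close>.\<close>

primrec lower_central :: "('a, 'b) monoid_scheme \<Rightarrow> nat \<Rightarrow> 'a set" where
  "lower_central G 0 = carrier G"
| "lower_central G (Suc k) = generate G
     {inv\<^bsub>G\<^esub> x \<otimes>\<^bsub>G\<^esub> inv\<^bsub>G\<^esub> y \<otimes>\<^bsub>G\<^esub> x \<otimes>\<^bsub>G\<^esub> y | x y. x \<in> lower_central G k \<and> y \<in> carrier G}"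

definition nilpotent_class_le :: "('a, 'b) monoid_scheme \<Rightarrow> nat \<Rightarrow> bool" where
  "nilpotent_class_le G c \<longleftrightarrow> lower_central G c = {\<one>\<^bsub>G\<^esub>}"

definition abelianization :: "('a, 'b) monoid_scheme \<Rightarrow> 'a set monoid" where
  "abelianization G = G Mod derived G (carrier G)"

definition mutually_coprime_abelianizations ::
    "'i set \<Rightarrow> ('i \<Rightarrow> ('a, 'b) monoid_scheme) \<Rightarrow> bool" where
  "mutually_coprime_abelianizations I A \<longleftrightarrow>
     (\<forall>i \<in> I. finite (carrier (abelianization (A i)))) \<and>
     (\<forall>i \<in> I. \<forall>j \<in> I. i \<noteq> j \<longrightarrow>
        coprime (order (abelianization (A i))) (order (abelianization (A j))))"

section \<open>Marginal subgroups are normal\<close>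

lemma weval_closed:
  assumes "group G" "\<rho> \<in> UNIV \<rightarrow> carrier G"
  shows "weval G \<rho> w \<in> carrier G"
proof -
  interpret group G by fact
  show ?thesis using assms(2) by (induction w) auto
qed

lemma weval_hom:
  assumes "group_hom G H h" "\<rho> \<in> UNIV \<rightarrow> carrier G"
  shows "h (weval G \<rho> w) = weval H (h \<circ> \<rho>) w"
proof -
  interpret group_hom G H h by fact
  have c: "weval G \<rho> w \<in> carrier G" for w
    using weval_closed[OF G.group_axioms assms(2)] .
  show ?thesis by (induction w) (auto simp: c)
qed

lemma marginalD:
  assumes "a \<in> marginal V E" "v \<in> V" "\<And>j. \<rho> j \<in> carrier E"
  shows "weval E (\<rho>(i := \<rho> i \<otimes>\<^bsub>E\<^esub> a)) v = weval E \<rho> v"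
  using assms unfolding marginal_def by blast

lemma marginalI:
  assumes "a \<in> carrier E"
    and "\<And>v \<rho> i. v \<in> V \<Longrightarrow> (\<And>j. \<rho> j \<in> carrier E) \<Longrightarrow>
           weval E (\<rho>(i := \<rho> i \<otimes>\<^bsub>E\<^esub> a)) v = weval E \<rho> v"
  shows "a \<in> marginal V E"
  using assms unfolding marginal_def by blast

lemma marginal_normal:
  fixes E :: "('a, 'b) monoid_scheme" and V :: "'v gword set"
  assumes "group E"
  shows "marginal V E \<lhd> E"
proof -
  interpret group E by fact
  have sub: "marginal V E \<subseteq> carrier E" by (auto simp: marginal_def)
  have one: "\<one>\<^bsub>E\<^esub> \<in> marginal V E"
    by (rule marginalI) auto
  have mult: "a \<otimes>\<^bsub>E\<^esub> b \<in> marginal V E" if a: "a \<in> marginal V E" and b: "b \<in> marginal V E" for a b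
  proof (rule marginalI)
    have ac: "a \<in> carrier E" "b \<in> carrier E" using a b sub by auto
    then show "a \<otimes>\<^bsub>E\<^esub> b \<in> carrier E" by simp
    fix v and \<rho> :: "'v \<Rightarrow> 'a" and i
    assume v: "v \<in> V" and r: "\<And>j. \<rho> j \<in> carrier E"
    let ?s = "\<rho>(i := \<rho> i \<otimes>\<^bsub>E\<^esub> a)"
    have s: "?s j \<in> carrier E" for j using r ac by simp
    have e: "\<rho>(i := \<rho> i \<otimes>\<^bsub>E\<^esub> (a \<otimes>\<^bsub>E\<^esub> b)) = ?s(i := ?s i \<otimes>\<^bsub>E\<^esub> b)"
      using ac r by (simp add: m_assoc)
    show "weval E (\<rho>(i := \<rho> i \<otimes>\<^bsub>E\<^esub> (a \<otimes>\<^bsub>E\<^esub> b))) v = weval E \<rho> v"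
      unfolding e by (rule trans[OF marginalD[where \<rho> = ?s, OF b v s] marginalD[where \<rho> = \<rho>, OF a v r]])
  qed
  have inv: "inv\<^bsub>E\<^esub> a \<in> marginal V E" if a: "a \<in> marginal V E" for a
  proof (rule marginalI)
    have ac: "a \<in> carrier E" using a sub by auto
    then show "inv\<^bsub>E\<^esub> a \<in> carrier E" by simp
    fix v and \<rho> :: "'v \<Rightarrow> 'a" and i
    assume v: "v \<in> V" and r: "\<And>j. \<rho> j \<in> carrier E"
    let ?s = "\<rho>(i := \<rho> i \<otimes>\<^bsub>E\<^esub> inv\<^bsub>E\<^esub> a)"
    have s: "?s j \<in> carrier E" for j using r ac by simp
    have e: "?s(i := ?s i \<otimes>\<^bsub>E\<^esub> a) = \<rho>"
      using ac r by (simp add: m_assoc)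
    show "weval E ?s v = weval E \<rho> v"
      using marginalD[where \<rho> = ?s and i = i, OF a v s] unfolding e by (rule sym)
  qed
  have conj: "x \<otimes>\<^bsub>E\<^esub> a \<otimes>\<^bsub>E\<^esub> inv\<^bsub>E\<^esub> x \<in> marginal V E"
    if a: "a \<in> marginal V E" and x: "x \<in> carrier E" for a x
  proof (rule marginalI)
    have ac: "a \<in> carrier E" using a sub by auto
    then show "x \<otimes>\<^bsub>E\<^esub> a \<otimes>\<^bsub>E\<^esub> inv\<^bsub>E\<^esub> x \<in> carrier E" using x by simp
    fix v and \<rho> :: "'v \<Rightarrow> 'a" and i
    assume v: "v \<in> V" and r: "\<And>j. \<rho> j \<in> carrier E"
    define h where "h = (\<lambda>y. x \<otimes>\<^bsub>E\<^esub> y \<otimes>\<^bsub>E\<^esub> inv\<^bsub>E\<^esub> x)"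
    define s where "s = (\<lambda>j. inv\<^bsub>E\<^esub> x \<otimes>\<^bsub>E\<^esub> \<rho> j \<otimes>\<^bsub>E\<^esub> x)"
    have canc: "x \<otimes>\<^bsub>E\<^esub> (inv\<^bsub>E\<^esub> x \<otimes>\<^bsub>E\<^esub> y) = y" "inv\<^bsub>E\<^esub> x \<otimes>\<^bsub>E\<^esub> (x \<otimes>\<^bsub>E\<^esub> y) = y"
      if "y \<in> carrier E" for y
      using x that by (simp_all add: m_assoc[symmetric])
    have hh: "group_hom E E h"
      using x by unfold_locales (simp add: h_def hom_def m_assoc canc)
    have s: "s j \<in> carrier E" for j using r x by (simp add: s_def)
    let ?t = "s(i := s i \<otimes>\<^bsub>E\<^esub> a)"
    have t: "?t j \<in> carrier E" for j using s ac by simp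
    have hs: "h (s j) = \<rho> j" for j
      using x r by (simp add: h_def s_def m_assoc canc)
    have hsa: "h (s i \<otimes>\<^bsub>E\<^esub> a) = \<rho> i \<otimes>\<^bsub>E\<^esub> h a"
      using group_hom.hom_mult[OF hh] s ac hs by (simp add: hom_mult)
    have c1: "h \<circ> s = \<rho>" using hs by auto
    have c2: "h \<circ> ?t = \<rho>(i := \<rho> i \<otimes>\<^bsub>E\<^esub> h a)" using hs hsa by auto
    have "weval E (\<rho>(i := \<rho> i \<otimes>\<^bsub>E\<^esub> h a)) v = h (weval E ?t v)"
      using weval_hom[OF hh, of ?t v] t c2 by auto
    also have "\<dots> = h (weval E s v)" using marginalD[where \<rho> = s and i = i, OF a v s] by simp
    also have "\<dots> = weval E \<rho> v" using weval_hom[OF hh, of s v] s c1 by auto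
    finally show "weval E (\<rho>(i := \<rho> i \<otimes>\<^bsub>E\<^esub> (x \<otimes>\<^bsub>E\<^esub> a \<otimes>\<^bsub>E\<^esub> inv\<^bsub>E\<^esub> x))) v = weval E \<rho> v"
      by (simp add: h_def)
  qed
  have "subgroup (marginal V E) E"
    using sub one mult inv by (intro subgroupI) auto
  then show ?thesis using conj by (simp add: normal_inv_iff)
qed

section \<open>Capability does not depend on the type of the witness\<close>

lemma capableI:
  fixes G :: "('a, 'b) monoid_scheme" and E :: "('e, 'f) monoid_scheme"
    and V :: "('v :: countable) gword set"
  assumes "group G" "group E" "G \<cong> E Mod marginal V E"
  shows "capable V G"
proof -
  interpret G: group G by fact
  interpret E: group E by fact
  let ?M = "marginal V E"
  interpret M: normal ?M E by (rule marginal_normal) fact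
  obtain \<phi> where \<phi>: "\<phi> \<in> iso (E Mod ?M) G"
    using assms(3) G.iso_sym unfolding is_iso_def by blast
  define \<pi> where "\<pi> = (\<lambda>x. \<phi> (?M #>\<^bsub>E\<^esub> x))"
  have fg: "group (E Mod ?M)" by (rule M.factorgroup_is_group)
  have qc: "?M #>\<^bsub>E\<^esub> x \<in> carrier (E Mod ?M)" if "x \<in> carrier E" for x
    using that by (auto simp: carrier_FactGroup)
  have \<pi>hom: "\<pi> \<in> hom E G"
  proof -
    have "\<phi> \<circ> (\<lambda>x. ?M #>\<^bsub>E\<^esub> x) \<in> hom E G"
      using M.r_coset_hom_Mod \<phi> by (intro hom_compose) (auto simp: iso_def)
    then show ?thesis by (simp add: \<pi>_def comp_def)
  qed
  interpret \<pi>: group_hom E G \<pi> by unfold_locales (rule \<pi>hom)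
  have inj: "inj_on \<phi> (carrier (E Mod ?M))" and img: "\<phi> ` carrier (E Mod ?M) = carrier G"
    using \<phi> by (auto simp: iso_def bij_betw_def)
  have \<phi>1: "\<phi> ?M = \<one>\<^bsub>G\<^esub>"
    using \<phi> hom_one[of \<phi> "E Mod ?M" G] fg assms(1) by (auto simp: iso_def)
  have \<pi>ker: "\<pi> x = \<one>\<^bsub>G\<^esub> \<longleftrightarrow> x \<in> ?M" if x: "x \<in> carrier E" for x
  proof -
    have "\<pi> x = \<one>\<^bsub>G\<^esub> \<longleftrightarrow> \<phi> (?M #>\<^bsub>E\<^esub> x) = \<phi> ?M" by (simp add: \<pi>_def \<phi>1)
    also have "\<dots> \<longleftrightarrow> ?M #>\<^bsub>E\<^esub> x = ?M"
      using inj qc[OF x] qc[OF E.one_closed] M.subset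
      by (auto simp: inj_on_def E.coset_mult_one)
    also have "\<dots> \<longleftrightarrow> x \<in> ?M"
      using E.coset_join1[OF _ x M.subgroup_axioms] E.coset_join2[OF x M.subgroup_axioms]
        M.rcos_const E.group_axioms by blast
    finally show ?thesis .
  qed
  have \<pi>surj: "\<pi> ` carrier E = carrier G"
    using img by (simp add: \<pi>_def carrier_FactGroup image_image)

  define r where "r = (\<lambda>g. SOME e. e \<in> carrier E \<and> \<pi> e = g)"
  have r: "r g \<in> carrier E \<and> \<pi> (r g) = g" if "g \<in> carrier G" for g
  proof -
    have "\<exists>e. e \<in> carrier E \<and> \<pi> e = g" using that unfolding \<pi>surj[symmetric] by blast
    then show ?thesis unfolding r_def by (rule someI_ex)
  qed

  define bad where "bad = (\<lambda>a \<rho>. (\<forall>j. \<rho> j \<in> carrier E) \<and>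
    (\<exists>v\<in>V. \<exists>i. weval E (\<rho>(i := \<rho> i \<otimes>\<^bsub>E\<^esub> a)) v \<noteq> weval E \<rho> v))"
  define w :: "'e \<Rightarrow> 'v \<Rightarrow> 'e" where
    "w = (\<lambda>a. if a \<in> carrier E - ?M then (SOME \<rho>. bad a \<rho>) else (\<lambda>_. \<one>\<^bsub>E\<^esub>))"
  have wbad: "bad a (w a)" if "a \<in> carrier E" "a \<notin> ?M" for a
  proof -
    have "\<exists>\<rho>. bad a \<rho>" using that marginalI[of a E V] unfolding bad_def by blast
    then show ?thesis using that someI_ex[of "bad a"] by (simp add: w_def)
  qed
  have wc: "w a j \<in> carrier E" for a j
  proof (cases "a \<in> carrier E - ?M")
    case True then show ?thesis using wbad[of a] by (auto simp: bad_def)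
  next
    case False
    then have "w a = (\<lambda>_. \<one>\<^bsub>E\<^esub>)" unfolding w_def by (rule if_not_P)
    then show ?thesis by simp
  qed

  define step where "step = (\<lambda>S. S \<union> ((\<lambda>(x, y). x \<otimes>\<^bsub>E\<^esub> y) ` (S \<times> S) \<union>
     (m_inv E ` S \<union> (\<lambda>(a, j). w a j) ` (S \<times> UNIV))))"
  define T where "T = (\<lambda>n. (step ^^ n) (insert \<one>\<^bsub>E\<^esub> (r ` carrier G)))"
  define E0 where "E0 = (\<Union>n. T n)"
  have T0: "T 0 = insert \<one>\<^bsub>E\<^esub> (r ` carrier G)" and TS: "T (Suc n) = step (T n)" for n
    by (simp_all add: T_def)
  have Tmono: "T m \<subseteq> T n" if "m \<le> n" for m n
    using that by (rule lift_Suc_mono_le[rotated]) (auto simp: TS step_def)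
  have Tsub: "T n \<subseteq> carrier E" for n
  proof (induction n)
    case 0 then show ?case using r by (auto simp: T0)
  next
    case (Suc n) then show ?case using wc by (auto simp: TS step_def)
  qed
  have E0sub: "E0 \<subseteq> carrier E" using Tsub by (auto simp: E0_def)
  have E0m: "x \<otimes>\<^bsub>E\<^esub> y \<in> E0" if "x \<in> E0" "y \<in> E0" for x y
  proof -
    obtain m n where "x \<in> T m" "y \<in> T n" using \<open>x \<in> E0\<close> \<open>y \<in> E0\<close> by (auto simp: E0_def)
    then have "x \<in> T (max m n)" "y \<in> T (max m n)" using Tmono[of m "max m n"] Tmono[of n "max m n"] by auto
    then have "x \<otimes>\<^bsub>E\<^esub> y \<in> T (Suc (max m n))" unfolding TS step_def by force
    then show ?thesis by (auto simp: E0_def)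
  qed
  have E0i: "inv\<^bsub>E\<^esub> x \<in> E0" if x: "x \<in> E0" for x
  proof -
    obtain n where "x \<in> T n" using x by (auto simp: E0_def)
    then have "inv\<^bsub>E\<^esub> x \<in> T (Suc n)" unfolding TS step_def by force
    then show ?thesis by (auto simp: E0_def)
  qed
  have E0w: "w x j \<in> E0" if x: "x \<in> E0" for x j
  proof -
    obtain n where "x \<in> T n" using x by (auto simp: E0_def)
    then have "w x j \<in> T (Suc n)" unfolding TS step_def by force
    then show ?thesis by (auto simp: E0_def)
  qed
  have E0r: "r g \<in> E0" if "g \<in> carrier G" for g
    using that T0 unfolding E0_def by blast
  have E01: "\<one>\<^bsub>E\<^esub> \<in> E0" using T0 unfolding E0_def by blast

  let ?L = "UNIV :: 'a list set"
  have infL: "infinite ?L" by (rule infinite_UNIV_listI)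
  have natL: "|UNIV :: nat set| \<le>o |?L|" using infL infinite_iff_card_of_nat by blast
  have vL: "|UNIV :: 'v set| \<le>o |?L|"
  proof -
    have "|UNIV :: 'v set| \<le>o |UNIV :: nat set|"
      using card_of_ordLeq[of "UNIV :: 'v set" "UNIV :: nat set"] inj_to_nat by blast
    then show ?thesis using natL ordLeq_transitive by blast
  qed
  have img_le: "|f ` S| \<le>o |?L|" if "|S| \<le>o |?L|" for f :: "'x \<Rightarrow> 'e" and S
    using card_of_image[of f S] that ordLeq_transitive by blast
  have stepL: "|step S| \<le>o |?L|" if S: "|S| \<le>o |?L|" for S
    unfolding step_def
    by (intro card_of_Un_ordLeq_infinite[OF infL] img_le card_of_Times_ordLeq_infinite[OF infL] S vL)
  have TL: "|T n| \<le>o |?L|" for n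
  proof (induction n)
    case 0
    have gL: "|carrier G| \<le>o |?L|"
      by (subst card_of_ordLeq[symmetric]) (rule exI[of _ "\<lambda>x. [x]"], auto simp: inj_on_def)
    have "|{\<one>\<^bsub>E\<^esub>} \<union> r ` carrier G| \<le>o |?L|"
      by (intro card_of_Un_ordLeq_infinite[OF infL] img_le[OF gL]) simp
    then show ?case by (simp add: T0)
  next
    case (Suc n) then show ?case unfolding TS by (rule stepL)
  qed
  have "|E0| \<le>o |?L|"
    unfolding E0_def by (rule card_of_UNION_ordLeq_infinite[OF infL natL]) (simp add: TL)
  then obtain f :: "'e \<Rightarrow> 'a list" where f: "inj_on f E0"
    unfolding card_of_ordLeq[symmetric] by blast

  define g where "g = inv_into E0 f"
  have gf: "g (f x) = x" if "x \<in> E0" for x using f that by (simp add: g_def)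
  define F :: "'a list monoid" where
    "F = \<lparr>carrier = f ` E0, monoid.mult = (\<lambda>x y. f (g x \<otimes>\<^bsub>E\<^esub> g y)), one = f \<one>\<^bsub>E\<^esub>\<rparr>"
  have Fs: "carrier F = f ` E0" "x \<otimes>\<^bsub>F\<^esub> y = f (g x \<otimes>\<^bsub>E\<^esub> g y)" "\<one>\<^bsub>F\<^esub> = f \<one>\<^bsub>E\<^esub>" for x y
    by (simp_all add: F_def)
  have E0E: "x \<in> carrier E" if "x \<in> E0" for x using E0sub that by blast
  have Fg: "group F"
  proof (rule groupI)
    show "\<exists>y\<in>carrier F. y \<otimes>\<^bsub>F\<^esub> x = \<one>\<^bsub>F\<^esub>" if "x \<in> carrier F" for x
      using that E0i by (intro bexI[of _ "f (inv\<^bsub>E\<^esub> g x)"]) (auto simp: Fs gf E0E)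
  qed (auto simp: Fs gf E0m E01 E0E E.m_assoc)
  have ghom: "group_hom F E g"
    using Fg E.group_axioms
    by (auto simp: group_hom_def group_hom_axioms_def hom_def Fs gf E0m E0E)
  have ginj: "inj_on g (carrier F)" by (auto simp: inj_on_def Fs gf)
  interpret F: group F by fact
  interpret g: group_hom F E g by fact

  have marg: "x \<in> marginal V F \<longleftrightarrow> g x \<in> ?M" if x: "x \<in> carrier F" for x
  proof
    assume gx: "g x \<in> ?M"
    show "x \<in> marginal V F"
    proof (rule marginalI[OF x])
      fix v and \<rho> :: "'v \<Rightarrow> 'a list" and i assume v: "v \<in> V" and \<rho>: "\<And>j. \<rho> j \<in> carrier F"
      let ?s = "\<rho>(i := \<rho> i \<otimes>\<^bsub>F\<^esub> x)"
      have s: "?s \<in> UNIV \<rightarrow> carrier F" and \<rho>': "\<rho> \<in> UNIV \<rightarrow> carrier F" using \<rho> x by auto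
      have c: "g \<circ> ?s = (g \<circ> \<rho>)(i := (g \<circ> \<rho>) i \<otimes>\<^bsub>E\<^esub> g x)" using \<rho> x by auto
      have "g (weval F ?s v) = weval E (g \<circ> ?s) v" by (rule weval_hom[OF ghom s])
      also have "\<dots> = weval E (g \<circ> \<rho>) v" unfolding c by (rule marginalD[OF gx v]) (simp add: \<rho>)
      also have "\<dots> = g (weval F \<rho> v)" by (rule weval_hom[OF ghom \<rho>', symmetric])
      finally show "weval F ?s v = weval F \<rho> v"
        using ginj weval_closed[OF Fg s] weval_closed[OF Fg \<rho>'] by (auto dest: inj_onD)
    qed
  next
    assume xm: "x \<in> marginal V F"
    show "g x \<in> ?M"
    proof (rule ccontr)
      assume n: "g x \<notin> ?M"
      have gx: "g x \<in> E0" using x by (auto simp: Fs gf)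
      define \<rho> where "\<rho> = f \<circ> w (g x)"
      have \<rho>: "\<rho> j \<in> carrier F" for j using E0w[OF gx] by (auto simp: \<rho>_def Fs)
      have g\<rho>: "g \<circ> \<rho> = w (g x)" using E0w[OF gx] by (auto simp: \<rho>_def gf)
      obtain v i where v: "v \<in> V"
        and ne: "weval E ((g \<circ> \<rho>)(i := (g \<circ> \<rho>) i \<otimes>\<^bsub>E\<^esub> g x)) v \<noteq> weval E (g \<circ> \<rho>) v"
        using wbad[OF E0E[OF gx] n] unfolding bad_def g\<rho> by blast
      let ?s = "\<rho>(i := \<rho> i \<otimes>\<^bsub>F\<^esub> x)"
      have s: "?s \<in> UNIV \<rightarrow> carrier F" and \<rho>': "\<rho> \<in> UNIV \<rightarrow> carrier F" using \<rho> x by auto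
      have c: "g \<circ> ?s = (g \<circ> \<rho>)(i := (g \<circ> \<rho>) i \<otimes>\<^bsub>E\<^esub> g x)" using \<rho> x by auto
      have "g (weval F ?s v) = g (weval F \<rho> v)" using marginalD[where \<rho> = \<rho> and i = i, OF xm v \<rho>] by simp
      then show False using ne weval_hom[OF ghom s] weval_hom[OF ghom \<rho>'] c by metis
    qed
  qed
  have \<psi>hom: "\<pi> \<circ> g \<in> hom F G" by (rule hom_compose[OF g.homh \<pi>hom])
  interpret \<psi>: group_hom F G "\<pi> \<circ> g" by unfold_locales (rule \<psi>hom)
  have ker: "kernel F G (\<pi> \<circ> g) = marginal V F"
  proof -
    have "marginal V F \<subseteq> carrier F" by (auto simp: marginal_def)
    then show ?thesis using marg \<pi>ker by (auto simp: kernel_def)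
  qed
  have surj: "(\<pi> \<circ> g) ` carrier F = carrier G"
  proof
    show "carrier G \<subseteq> (\<pi> \<circ> g) ` carrier F"
    proof
      fix y assume y: "y \<in> carrier G"
      then have "(\<pi> \<circ> g) (f (r y)) = y" "f (r y) \<in> carrier F"
        using r E0r by (auto simp: gf Fs)
      then show "y \<in> (\<pi> \<circ> g) ` carrier F" by (metis imageI)
    qed
  qed (use \<psi>.hom_closed in auto)
  have "F Mod marginal V F \<cong> G"
    using \<psi>.FactGroup_iso[OF surj] unfolding ker .
  then have "G \<cong> F Mod marginal V F"
    using group.iso_sym[OF normal.factorgroup_is_group[OF marginal_normal[OF Fg]]] by blast
  then show ?thesis unfolding capable_def using Fg by blast
qed

end

theory Submission
  imports Defs
begin

text \<open>Componentwise evaluation of words shows that the marginal subgroup of a product is the product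
  of the marginal subgroups, so products of capable groups are capable.

  Conversely let \<open>E/M\<close> be the product, \<open>M\<close> marginal in \<open>E\<close>, and let \<open>P\<close> and \<open>Q\<close> be the preimages of
  one factor and of the product of the others. It suffices that \<open>M\<close> is the whole marginal subgroup of
  \<open>P\<close>. A polynilpotent word is a commutator bracketing \<open>v\<close> of distinct variables, so it can be applied
  to normal subgroups, \<open>v(K\<^sub>1, \<dots>, K\<^sub>m)\<close>, and a normal subgroup \<open>N\<close> is marginal iff \<open>v\<close> is trivial
  whenever one argument is \<open>N\<close> and the others are \<open>E = P Q\<close>. Hence it is enough to show that
  \<open>v(K\<^sub>1, \<dots>, K\<^sub>m)\<close> is trivial as soon as one argument lies in \<open>P\<close> and another in \<open>Q\<close>. If it is trivial
  after replacing any \<open>K\<^sub>j\<close> by \<open>[K\<^sub>j, E]\<close>, then \<open>v\<close> is multilinear on the \<open>K\<^sub>j\<close>, so its values are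
  killed by the coprime exponents of \<open>P/M\<close> and \<open>Q/M\<close>. Since \<open>E/M\<close> is nilpotent, finitely many such
  replacements push some argument into \<open>M\<close>, where \<open>v\<close> vanishes. The exponents are coprime because the
  exponent of a nilpotent group divides a power of the order of its abelianization.\<close>

section \<open>Commutators modulo a normal subgroup\<close>

text \<open>The convention is that of \<open>wcomm\<close> and \<open>lower_central\<close>, so
  words, trees and the series agree up to associativity.\<close>

definition commutator :: "('a, 'b) monoid_scheme \<Rightarrow> 'a \<Rightarrow> 'a \<Rightarrow> 'a" where
  "commutator G x y = inv\<^bsub>G\<^esub> x \<otimes>\<^bsub>G\<^esub> inv\<^bsub>G\<^esub> y \<otimes>\<^bsub>G\<^esub> x \<otimes>\<^bsub>G\<^esub> y"

definition commutator_subgroup :: "('a, 'b) monoid_scheme \<Rightarrow> 'a set \<Rightarrow> 'a set \<Rightarrow> 'a set" where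
  "commutator_subgroup G H K = generate G {commutator G x y | x y. x \<in> H \<and> y \<in> K}"

text \<open>For normal \<open>D\<close> this is the preimage of the centralizer of the image of
  \<open>W\<close> in \<open>G/D\<close>. Staying inside \<open>G\<close> lets the inductions on
  trees nest it, one centralizer modulo another, without iterated quotients.\<close>

definition centralizer_mod :: "('a, 'b) monoid_scheme \<Rightarrow> 'a set \<Rightarrow> 'a set \<Rightarrow> 'a set" where
  "centralizer_mod G D W = {u \<in> carrier G. \<forall>w \<in> W. commutator G u w \<in> D}"

definition cong_mod :: "('a, 'b) monoid_scheme \<Rightarrow> 'a set \<Rightarrow> 'a \<Rightarrow> 'a \<Rightarrow> bool" where
  "cong_mod G D x y \<longleftrightarrow> inv\<^bsub>G\<^esub> x \<otimes>\<^bsub>G\<^esub> y \<in> D"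

context group
begin

lemma inv_cancel_left:
  assumes "x \<in> carrier G" "y \<in> carrier G"
  shows "x \<otimes> (inv x \<otimes> y) = y" "inv x \<otimes> (x \<otimes> y) = y"
  using assms by (simp_all add: m_assoc[symmetric])

lemmas group_word_simps = commutator_def m_assoc inv_mult_group inv_cancel_left

lemma commutator_closed [simp, intro]:
  "x \<in> carrier G \<Longrightarrow> y \<in> carrier G \<Longrightarrow> commutator G x y \<in> carrier G"
  by (simp add: commutator_def)

lemma commutator_one [simp]:
  "x \<in> carrier G \<Longrightarrow> commutator G x \<one> = \<one>" "x \<in> carrier G \<Longrightarrow> commutator G \<one> x = \<one>"
  by (simp_all add: commutator_def)

text \<open>This is \<open>[x y, z] = [x,z]^y [y,z]\<close> with the conjugate written as
  \<open>[x,z] [[x,z],y]\<close>, so that the deviation from multiplicativity is itself a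
  commutator.\<close>

lemma commutator_mult_left:
  assumes "x \<in> carrier G" "y \<in> carrier G" "z \<in> carrier G"
  shows "commutator G (x \<otimes> y) z = commutator G x z \<otimes> commutator G (commutator G x z) y \<otimes> commutator G y z"
  using assms by (simp add: group_word_simps)

lemma commutator_mult_right:
  assumes "x \<in> carrier G" "y \<in> carrier G" "z \<in> carrier G"
  shows "commutator G x (y \<otimes> z) = commutator G x z \<otimes> commutator G x y \<otimes> commutator G (commutator G x y) z"
  using assms by (simp add: group_word_simps)

lemma inv_commutator:
  assumes "x \<in> carrier G" "y \<in> carrier G"
  shows "inv (commutator G x y) = commutator G y x"
  using assms by (simp add: group_word_simps)

lemma commutator_inv_left:
  assumes "x \<in> carrier G" "y \<in> carrier G"
  shows "commutator G (inv x) y = x \<otimes> commutator G y x \<otimes> inv x"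
  using assms by (simp add: group_word_simps)

lemma conj_commutator:
  assumes "x \<in> carrier G" "y \<in> carrier G" "g \<in> carrier G"
  shows "g \<otimes> commutator G x y \<otimes> inv g = commutator G (g \<otimes> x \<otimes> inv g) (g \<otimes> y \<otimes> inv g)"
  using assms by (simp add: group_word_simps)

lemma conj_eq_mult_commutator:
  assumes "x \<in> carrier G" "g \<in> carrier G"
  shows "g \<otimes> x \<otimes> inv g = x \<otimes> commutator G x (inv g)"
  using assms by (simp add: group_word_simps)

lemma normal_conj:
  assumes "N \<lhd> G" "x \<in> N" "g \<in> carrier G"
  shows "g \<otimes> x \<otimes> inv g \<in> N" "inv g \<otimes> x \<otimes> g \<in> N"
  using normal.inv_op_closed1[OF assms(1)] normal.inv_op_closed2[OF assms(1)] assms by auto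

lemma normal_closed:
  assumes "N \<lhd> G"
  shows "x \<in> N \<Longrightarrow> x \<in> carrier G" "\<one> \<in> N" "x \<in> N \<Longrightarrow> y \<in> N \<Longrightarrow> x \<otimes> y \<in> N" "x \<in> N \<Longrightarrow> inv x \<in> N"
  using normal_imp_subgroup[OF assms] subgroup.mem_carrier subgroup.one_closed subgroup.m_closed
    subgroup.m_inv_closed by fast+

lemma normalI_closed:
  assumes "N \<subseteq> carrier G" "\<one> \<in> N" "\<And>x y. x \<in> N \<Longrightarrow> y \<in> N \<Longrightarrow> x \<otimes> y \<in> N"
    "\<And>x. x \<in> N \<Longrightarrow> inv x \<in> N" "\<And>x g. x \<in> N \<Longrightarrow> g \<in> carrier G \<Longrightarrow> g \<otimes> x \<otimes> inv g \<in> N"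
  shows "N \<lhd> G"
proof -
  have "subgroup N G" using assms by (intro subgroupI) auto
  then show ?thesis using assms(5) by (simp add: normal_inv_iff)
qed

lemma normal_commutator_left:
  assumes "N \<lhd> G" "x \<in> N" "g \<in> carrier G"
  shows "commutator G x g \<in> N"
proof -
  have x: "x \<in> carrier G" using normal_closed[OF assms(1)] assms(2) by blast
  have "commutator G x g = inv x \<otimes> (inv g \<otimes> x \<otimes> g)"
    using x assms(3) by (simp add: commutator_def m_assoc)
  then show ?thesis using normal_closed[OF assms(1)] normal_conj[OF assms(1)] assms by simp
qed

lemma normal_commutator_right:
  assumes "N \<lhd> G" "x \<in> N" "g \<in> carrier G"
  shows "commutator G g x \<in> N"
  using normal_commutator_left[OF assms] normal_closed[OF assms(1)] assms inv_commutator[of x g] by metis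

lemma normal_trivial: "{\<one>} \<lhd> G"
  by (rule normalI_closed) auto

lemma normal_carrier: "carrier G \<lhd> G"
  by (rule normalI_closed) auto

lemma commutator_subgroup_leI:
  assumes "subgroup D G" "\<And>x y. x \<in> H \<Longrightarrow> y \<in> K \<Longrightarrow> commutator G x y \<in> D"
  shows "commutator_subgroup G H K \<subseteq> D"
  unfolding commutator_subgroup_def using assms by (intro generate_subgroup_incl) auto

lemma commutator_in_commutator_subgroup:
  "x \<in> H \<Longrightarrow> y \<in> K \<Longrightarrow> commutator G x y \<in> commutator_subgroup G H K"
  unfolding commutator_subgroup_def by (intro generate.incl) blast

lemma normal_commutator_subgroup:
  assumes H: "H \<lhd> G" and K: "K \<lhd> G"
  shows "commutator_subgroup G H K \<lhd> G"
  unfolding commutator_subgroup_def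
proof (rule normal_generateI)
  show "{commutator G x y |x y. x \<in> H \<and> y \<in> K} \<subseteq> carrier G"
    using normal_closed(1)[OF H] normal_closed(1)[OF K] by blast
next
  fix h g assume "h \<in> {commutator G x y |x y. x \<in> H \<and> y \<in> K}" and g: "g \<in> carrier G"
  then obtain x y where xy: "h = commutator G x y" "x \<in> H" "y \<in> K" by blast
  then have "g \<otimes> h \<otimes> inv g = commutator G (g \<otimes> x \<otimes> inv g) (g \<otimes> y \<otimes> inv g)"
    using conj_commutator g normal_closed(1)[OF H] normal_closed(1)[OF K] by simp
  then show "g \<otimes> h \<otimes> inv g \<in> {commutator G x y |x y. x \<in> H \<and> y \<in> K}"
    using normal_conj[OF H xy(2) g] normal_conj[OF K xy(3) g] by blast
qed

section \<open>Centralizers modulo a normal subgroup\<close>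

lemma centralizer_modD:
  assumes "u \<in> centralizer_mod G D W" "w \<in> W"
  shows "u \<in> carrier G" "commutator G u w \<in> D"
  using assms by (auto simp: centralizer_mod_def)

lemma centralizer_modD':
  assumes "D \<lhd> G" "u \<in> centralizer_mod G D W" "w \<in> W" "w \<in> carrier G"
  shows "commutator G w u \<in> D"
  using centralizer_modD[OF assms(2,3)] normal_closed(4)[OF assms(1)] inv_commutator[of u w] assms(4)
  by metis

lemma centralizer_mod_sym:
  assumes "D \<lhd> G" "U \<subseteq> centralizer_mod G D W" "W \<subseteq> carrier G"
  shows "W \<subseteq> centralizer_mod G D U"
  using centralizer_modD'[OF assms(1)] assms(2,3) unfolding centralizer_mod_def[of G D U] by blast

text \<open>This equivalence drives the inductions on trees: a bound on a commutator subgroup is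
  traded for a bound on one of its arguments.\<close>

lemma centralizer_mod_iff:
  assumes "D \<lhd> G" "U \<lhd> G"
  shows "U \<subseteq> centralizer_mod G D W \<longleftrightarrow> commutator_subgroup G U W \<subseteq> D"
proof
  show "commutator_subgroup G U W \<subseteq> D" if "U \<subseteq> centralizer_mod G D W"
    by (rule commutator_subgroup_leI[OF normal_imp_subgroup[OF assms(1)]])
      (use that in \<open>auto simp: centralizer_mod_def\<close>)
  show "U \<subseteq> centralizer_mod G D W" if "commutator_subgroup G U W \<subseteq> D"
    using that commutator_in_commutator_subgroup normal_closed(1)[OF assms(2)]
    unfolding centralizer_mod_def by blast
qed

text \<open>\<open>W\<close> is a conjugation-invariant set rather than a subgroup, because
  \<open>tree_subgroup_leI\<close> takes for \<open>W\<close> the set of values of a word.\<close>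

lemma normal_centralizer_mod:
  assumes D: "D \<lhd> G" and W: "W \<subseteq> carrier G"
    and conj: "\<And>w g. w \<in> W \<Longrightarrow> g \<in> carrier G \<Longrightarrow> g \<otimes> w \<otimes> inv g \<in> W"
  shows "centralizer_mod G D W \<lhd> G"
proof (rule normalI_closed)
  note Dc = normal_closed[OF D]
  show "centralizer_mod G D W \<subseteq> carrier G" by (auto simp: centralizer_mod_def)
  show "\<one> \<in> centralizer_mod G D W" using W Dc(2) by (auto simp: centralizer_mod_def subset_iff)
  fix x assume x: "x \<in> centralizer_mod G D W"
  then have xc: "x \<in> carrier G" by (simp add: centralizer_mod_def)
  show "inv x \<in> centralizer_mod G D W"
  proof -
    have "commutator G (inv x) w \<in> D" if w: "w \<in> W" for w
    proof -
      have wc: "w \<in> carrier G" using w W by blast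
      show ?thesis
        unfolding commutator_inv_left[OF xc wc]
        by (rule normal_conj(1)[OF D centralizer_modD'[OF D x w wc] xc])
    qed
    then show ?thesis using xc by (auto simp: centralizer_mod_def)
  qed
  show "x \<otimes> y \<in> centralizer_mod G D W" if y: "y \<in> centralizer_mod G D W" for y
  proof -
    have yc: "y \<in> carrier G" using y by (simp add: centralizer_mod_def)
    have "commutator G (x \<otimes> y) w \<in> D" if w: "w \<in> W" for w
    proof -
      have wc: "w \<in> carrier G" using w W by blast
      show ?thesis
        unfolding commutator_mult_left[OF xc yc wc]
        by (intro Dc(3) centralizer_modD(2)[OF x w] centralizer_modD(2)[OF y w]
            normal_commutator_left[OF D _ yc])
    qed
    then show ?thesis using xc yc by (auto simp: centralizer_mod_def)
  qed
  show "g \<otimes> x \<otimes> inv g \<in> centralizer_mod G D W" if g: "g \<in> carrier G" for g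
  proof -
    have "commutator G (g \<otimes> x \<otimes> inv g) w \<in> D" if w: "w \<in> W" for w
    proof -
      have wc: "w \<in> carrier G" using w W by blast
      have w': "inv g \<otimes> w \<otimes> g \<in> W" using conj[OF w, of "inv g"] g by simp
      have "commutator G (g \<otimes> x \<otimes> inv g) w = g \<otimes> commutator G x (inv g \<otimes> w \<otimes> g) \<otimes> inv g"
        using g xc wc by (simp add: group_word_simps)
      then show ?thesis using normal_conj[OF D centralizer_modD(2)[OF x w'] g] by simp
    qed
    then show ?thesis using xc g by (auto simp: centralizer_mod_def)
  qed
qed

lemma normal_centralizer_mod_normal:
  assumes "D \<lhd> G" "W \<lhd> G"
  shows "centralizer_mod G D W \<lhd> G"
  using assms normal_closed(1)[OF assms(2)] normal_conj[OF assms(2)] by (intro normal_centralizer_mod) auto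

section \<open>Congruences between commutators\<close>

lemma cong_mod_trivial:
  assumes "x \<in> carrier G" "y \<in> carrier G"
  shows "cong_mod G {\<one>} x y \<longleftrightarrow> x = y"
proof
  assume "cong_mod G {\<one>} x y"
  then have "x \<otimes> (inv x \<otimes> y) = x \<otimes> \<one>" by (simp add: cong_mod_def)
  then show "x = y" using assms by (simp add: inv_cancel_left)
qed (use assms in \<open>simp add: cong_mod_def\<close>)

lemma cong_mod_trans:
  assumes "D \<lhd> G" "cong_mod G D x y" "cong_mod G D y z"
    "x \<in> carrier G" "y \<in> carrier G" "z \<in> carrier G"
  shows "cong_mod G D x z"
proof -
  have "inv x \<otimes> z = (inv x \<otimes> y) \<otimes> (inv y \<otimes> z)" using assms by (simp add: group_word_simps)
  then show ?thesis using assms normal_closed(3) unfolding cong_mod_def by simp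
qed

text \<open>Write \<open>y = x t\<close>, where \<open>t\<close> centralizes \<open>W\<close> modulo
  \<open>D\<close>. Expanding \<open>[x t, h]\<close> leaves the error terms
  \<open>[[x,h],t]\<close> and \<open>[t,h]\<close>. Both lie in \<open>D\<close>, the first because
  normality of \<open>W\<close> puts \<open>[x,h]\<close> into \<open>W\<close>.\<close>

lemma commutator_cong_left:
  assumes D: "D \<lhd> G" and W: "W \<lhd> G" and h: "h \<in> W"
    and xy: "x \<in> carrier G" "y \<in> carrier G" "cong_mod G (centralizer_mod G D W) x y"
  shows "cong_mod G D (commutator G x h) (commutator G y h)"
proof -
  define t where "t = inv x \<otimes> y"
  have t: "t \<in> centralizer_mod G D W" using xy by (simp add: t_def cong_mod_def)
  have tc: "t \<in> carrier G" "h \<in> carrier G" using xy h normal_closed[OF W] by (auto simp: t_def)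
  have y: "y = x \<otimes> t" using xy by (simp add: t_def inv_cancel_left)
  have "inv (commutator G x h) \<otimes> commutator G y h = commutator G (commutator G x h) t \<otimes> commutator G t h"
    unfolding y using commutator_mult_left[OF xy(1) tc] xy tc by (simp add: m_assoc inv_cancel_left)
  moreover have "commutator G (commutator G x h) t \<in> D"
    using centralizer_modD'[OF D t normal_commutator_right[OF W h xy(1)]] xy tc by simp
  ultimately show ?thesis
    using centralizer_modD(2)[OF t h] normal_closed(3)[OF D] by (simp add: cong_mod_def)
qed

lemma commutator_cong_right:
  assumes D: "D \<lhd> G" and W: "W \<lhd> G" and h: "h \<in> W"
    and xy: "x \<in> carrier G" "y \<in> carrier G" "cong_mod G (centralizer_mod G D W) x y"
  shows "cong_mod G D (commutator G h x) (commutator G h y)"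
proof -
  define t where "t = inv x \<otimes> y"
  have t: "t \<in> centralizer_mod G D W" using xy by (simp add: t_def cong_mod_def)
  have tc: "t \<in> carrier G" "h \<in> carrier G" using xy h normal_closed[OF W] by (auto simp: t_def)
  have y: "y = x \<otimes> t" using xy by (simp add: t_def inv_cancel_left)
  have "inv (commutator G h x) \<otimes> commutator G h y =
      (inv (commutator G h x) \<otimes> commutator G h t \<otimes> commutator G h x) \<otimes> commutator G (commutator G h x) t"
    unfolding y using commutator_mult_right[OF tc(2) xy(1) tc(1)] xy tc by (simp add: m_assoc)
  moreover have "commutator G (commutator G h x) t \<in> D"
    using centralizer_modD'[OF D t normal_commutator_left[OF W h xy(1)]] xy tc by simp
  moreover have "inv (commutator G h x) \<otimes> commutator G h t \<otimes> commutator G h x \<in> D"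
    using normal_conj(2)[OF D centralizer_modD'[OF D t h]] xy tc by simp
  ultimately show ?thesis
    using normal_closed(3)[OF D] by (simp add: cong_mod_def)
qed

text \<open>A form of the three subgroups lemma.\<close>

lemma commutator_central_mod:
  assumes D: "D \<lhd> G" and U: "U \<lhd> G" and W: "W \<lhd> G" and uw: "u \<in> U" "w \<in> W"
    and g: "g \<in> carrier G"
    and UG: "\<And>u g. u \<in> U \<Longrightarrow> g \<in> carrier G \<Longrightarrow> commutator G u g \<in> centralizer_mod G D W"
    and WG: "\<And>w g. w \<in> W \<Longrightarrow> g \<in> carrier G \<Longrightarrow> commutator G w g \<in> centralizer_mod G D U"
  shows "commutator G (commutator G u w) g \<in> D"
proof -
  have c: "u \<in> carrier G" "w \<in> carrier G" using normal_closed[OF U] normal_closed[OF W] uw by auto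
  \<comment> \<open>Conjugation by \<open>g\<close> changes \<open>u\<close> by \<open>[u,g]\<close>
    and \<open>w\<close> by \<open>[w,g]\<close>, and the commutator cannot see either change modulo
    \<open>D\<close>. Conjugating both entries, however, conjugates \<open>[u,w]\<close>, that is,
    multiplies it by \<open>[[u,w],g]\<close>.\<close>
  define u' where "u' = inv g \<otimes> u \<otimes> g"
  define w' where "w' = inv g \<otimes> w \<otimes> g"
  have c': "u' \<in> carrier G" "w' \<in> carrier G" using c g by (auto simp: u'_def w'_def)
  have w': "w' \<in> W" using normal_conj[OF W uw(2) g] by (simp add: w'_def)
  have e: "inv u \<otimes> u' = commutator G u g" "inv w \<otimes> w' = commutator G w g"
    using c g by (simp_all add: u'_def w'_def group_word_simps)
  have 1: "cong_mod G D (commutator G u w') (commutator G u' w')"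
    by (rule commutator_cong_left[OF D W w' c(1) c'(1)]) (simp add: cong_mod_def e UG[OF uw(1) g])
  have 2: "cong_mod G D (commutator G u w) (commutator G u w')"
    by (rule commutator_cong_right[OF D U uw(1) c(2) c'(2)]) (simp add: cong_mod_def e WG[OF uw(2) g])
  have "cong_mod G D (commutator G u w) (commutator G u' w')"
    using cong_mod_trans[OF D 2 1] c c' by simp
  moreover have "inv (commutator G u w) \<otimes> commutator G u' w' = commutator G (commutator G u w) g"
    using c g by (simp add: u'_def w'_def group_word_simps)
  ultimately show ?thesis by (simp add: cong_mod_def)
qed

lemma commutator_mult_left_mod:
  assumes D: "D \<lhd> G" and c: "x \<in> carrier G" "y \<in> carrier G" "h \<in> carrier G"
    and "commutator G (commutator G x h) y \<in> D"
  shows "cong_mod G D (commutator G x h \<otimes> commutator G y h) (commutator G (x \<otimes> y) h)"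
proof -
  have "inv (commutator G x h \<otimes> commutator G y h) \<otimes> commutator G (x \<otimes> y) h =
     inv (commutator G y h) \<otimes> commutator G (commutator G x h) y \<otimes> commutator G y h"
    using c by (simp add: commutator_mult_left m_assoc inv_mult_group inv_cancel_left)
  then show ?thesis using normal_conj(2)[OF D assms(5)] c by (simp add: cong_mod_def)
qed

text \<open>The expansion of \<open>[h, x y]\<close> lists \<open>[h,y]\<close> before
  \<open>[h,x]\<close>. Restoring the order costs a commutator of these two, hence one more
  assumption than on the left.\<close>

lemma commutator_mult_right_mod:
  assumes D: "D \<lhd> G" and c: "x \<in> carrier G" "y \<in> carrier G" "h \<in> carrier G"
    and a: "commutator G (commutator G h x) (commutator G h y) \<in> D" "commutator G (commutator G h x) y \<in> D"
  shows "cong_mod G D (commutator G h x \<otimes> commutator G h y) (commutator G h (x \<otimes> y))"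
proof -
  have "inv (commutator G h x \<otimes> commutator G h y) \<otimes> commutator G h (x \<otimes> y) =
     commutator G (commutator G h y) (commutator G h x) \<otimes> commutator G (commutator G h x) y"
    unfolding commutator_mult_right[OF c(3,1,2)]
    by (subst (4) commutator_def) (use c in \<open>simp add: m_assoc inv_mult_group inv_cancel_left\<close>)
  moreover have "commutator G (commutator G h y) (commutator G h x) \<in> D"
    using normal_closed(4)[OF D a(1)] c by (simp add: inv_commutator)
  ultimately show ?thesis using normal_closed(3)[OF D] a(2) by (simp add: cong_mod_def)
qed

end

section \<open>Outer commutator words\<close>

text \<open>The tree records the bracketing that a \<open>gword\<close> hides, so that one shape can
  be evaluated both at elements (\<open>tree_word\<close>) and at subgroups
  (\<open>tree_subgroup\<close>).\<close>

datatype (leaves: 'v) comm_tree = Leaf 'v | Comm "'v comm_tree" "'v comm_tree"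
  for map: map_comm_tree

primrec tree_word :: "'v comm_tree \<Rightarrow> 'v gword" where
  "tree_word (Leaf j) = WVar j"
| "tree_word (Comm l r) = wcomm (tree_word l) (tree_word r)"

text \<open>No variable repeats: the words of such trees are the outer commutator words.\<close>

primrec disjoint_leaves :: "'v comm_tree \<Rightarrow> bool" where
  "disjoint_leaves (Leaf j) \<longleftrightarrow> True"
| "disjoint_leaves (Comm l r) \<longleftrightarrow> leaves l \<inter> leaves r = {} \<and> disjoint_leaves l \<and> disjoint_leaves r"

primrec tree_subgroup :: "('a, 'b) monoid_scheme \<Rightarrow> ('v \<Rightarrow> 'a set) \<Rightarrow> 'v comm_tree \<Rightarrow> 'a set" where
  "tree_subgroup G K (Leaf j) = K j"
| "tree_subgroup G K (Comm l r) = commutator_subgroup G (tree_subgroup G K l) (tree_subgroup G K r)"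

lemma finite_leaves [simp]: "finite (leaves t)"
  by (induction t) auto

lemma weval_tree_cong:
  "(\<And>j. j \<in> leaves t \<Longrightarrow> \<rho> j = \<sigma> j) \<Longrightarrow> weval G \<rho> (tree_word t) = weval G \<sigma> (tree_word t)"
  by (induction t) (auto simp: wcomm_def)

lemma tree_subgroup_cong:
  "(\<And>j. j \<in> leaves t \<Longrightarrow> K j = L j) \<Longrightarrow> tree_subgroup G K t = tree_subgroup G L t"
  by (induction t) auto

lemma fun_upd_not_leaf [simp]:
  assumes "j \<notin> leaves t"
  shows "tree_subgroup G (K(j := Z)) t = tree_subgroup G K t"
    "weval G (\<rho>(j := x)) (tree_word t) = weval G \<rho> (tree_word t)"
  by (rule tree_subgroup_cong, use assms in auto) (rule weval_tree_cong, use assms in auto)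

context group
begin

lemma normal_tree_subgroup:
  "(\<And>j. K j \<lhd> G) \<Longrightarrow> tree_subgroup G K t \<lhd> G"
  by (induction t) (auto intro: normal_commutator_subgroup)

lemma weval_tree_closed [simp]:
  "(\<And>j. \<rho> j \<in> carrier G) \<Longrightarrow> weval G \<rho> (tree_word t) \<in> carrier G"
  by (rule weval_closed[OF group_axioms]) auto

lemma weval_Comm:
  assumes "\<And>j. \<rho> j \<in> carrier G"
  shows "weval G \<rho> (tree_word (Comm l r)) =
    commutator G (weval G \<rho> (tree_word l)) (weval G \<rho> (tree_word r))"
  using assms by (simp add: wcomm_def commutator_def m_assoc)

lemma weval_in_tree_subgroup:
  assumes "\<And>j. K j \<lhd> G" "\<And>j. \<rho> j \<in> K j"
  shows "weval G \<rho> (tree_word t) \<in> tree_subgroup G K t"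
proof (induction t)
  case (Comm l r)
  have "\<rho> j \<in> carrier G" for j using normal_closed(1)[OF assms(1)] assms(2) by blast
  then show ?case
    using commutator_in_commutator_subgroup[OF Comm] weval_Comm[of \<rho> l r] by simp
qed (use assms in simp)

lemma weval_tree_one:
  assumes "\<And>j. \<rho> j \<in> carrier G" "i \<in> leaves t" "\<rho> i = \<one>"
  shows "weval G \<rho> (tree_word t) = \<one>"
  using assms(2)
proof (induction t)
  case (Comm l r)
  have "weval G \<rho> (tree_word l) \<in> carrier G" "weval G \<rho> (tree_word r) \<in> carrier G"
    using assms(1) by simp_all
  then show ?case using Comm by (auto simp: weval_Comm[OF assms(1)] simp del: tree_word.simps)
qed (use assms in simp)

lemma conj_weval:
  assumes "\<And>j. \<rho> j \<in> carrier G" "g \<in> carrier G"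
  shows "g \<otimes> weval G \<rho> (tree_word t) \<otimes> inv g = weval G (\<lambda>j. g \<otimes> \<rho> j \<otimes> inv g) (tree_word t)"
proof (induction t)
  case (Comm l r)
  have c: "g \<otimes> \<rho> j \<otimes> inv g \<in> carrier G" for j using assms by simp
  show ?case
    using conj_commutator[OF weval_tree_closed weval_tree_closed, of \<rho> \<rho> g l r] Comm assms
    by (simp add: weval_Comm[OF assms(1)] weval_Comm[OF c] del: tree_word.simps)
qed simp

text \<open>Disjoint leaves allow the entries of the two halves to be chosen independently, so every
  value of \<open>l\<close> centralizes every value of \<open>r\<close> modulo \<open>D\<close>. The
  induction hypothesis for \<open>l\<close>, with that centralizer as the new bound, passes from
  values of \<open>l\<close> to its subgroup. Exchanging the sides and applying the hypothesis for
  \<open>r\<close> does the same there.\<close>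

lemma tree_subgroup_leI:
  assumes "disjoint_leaves t" "D \<lhd> G" "\<And>j. K j \<lhd> G"
    "\<And>\<rho>. (\<And>j. \<rho> j \<in> K j) \<Longrightarrow> weval G \<rho> (tree_word t) \<in> D"
  shows "tree_subgroup G K t \<subseteq> D"
  using assms
proof (induction t arbitrary: D)
  case (Leaf i)
  show ?case
  proof
    fix x assume "x \<in> tree_subgroup G K (Leaf i)"
    then have "((\<lambda>_. \<one>)(i := x)) j \<in> K j" for j
      using normal_closed(2)[OF Leaf(3)] by simp
    from Leaf(4)[OF this] show "x \<in> D" by simp
  qed
next
  case (Comm l r)
  note D = Comm.prems(2) and K = Comm.prems(3)
  have Kc: "x \<in> carrier G" if "x \<in> K j" for x j using normal_closed(1)[OF K that] .
  define V where "V = {weval G \<rho> (tree_word r) |\<rho>. \<forall>j. \<rho> j \<in> K j}"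
  have V: "V \<subseteq> carrier G"
    unfolding V_def using Kc by (auto intro!: weval_closed[OF group_axioms])
  have conj: "g \<otimes> w \<otimes> inv g \<in> V" if w: "w \<in> V" and g: "g \<in> carrier G" for w g
  proof -
    obtain \<rho> where \<rho>: "w = weval G \<rho> (tree_word r)" "\<And>j. \<rho> j \<in> K j" using w by (auto simp: V_def)
    have "\<rho> j \<in> carrier G" for j using Kc \<rho>(2) .
    then have "g \<otimes> w \<otimes> inv g = weval G (\<lambda>j. g \<otimes> \<rho> j \<otimes> inv g) (tree_word r)"
      unfolding \<rho>(1) by (rule conj_weval[OF _ g])
    moreover have "g \<otimes> \<rho> j \<otimes> inv g \<in> K j" for j using normal_conj(1)[OF K \<rho>(2) g] .
    ultimately show ?thesis unfolding V_def by blast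
  qed
  have "tree_subgroup G K l \<subseteq> centralizer_mod G D V"
  proof (rule Comm.IH(1))
    fix \<rho> assume \<rho>: "\<And>j. \<rho> j \<in> K j"
    have "commutator G (weval G \<rho> (tree_word l)) w \<in> D" if w: "w \<in> V" for w
    proof -
      obtain \<sigma> where \<sigma>: "w = weval G \<sigma> (tree_word r)" "\<And>j. \<sigma> j \<in> K j"
        using w unfolding V_def by blast
      \<comment> \<open>One assignment realizing both values at once.\<close>
      define \<tau> where "\<tau> = (\<lambda>j. if j \<in> leaves l then \<rho> j else \<sigma> j)"
      have \<tau>: "\<tau> j \<in> K j" for j using \<rho> \<sigma> by (simp add: \<tau>_def)
      have "weval G \<rho> (tree_word l) = weval G \<tau> (tree_word l)" "w = weval G \<tau> (tree_word r)"
        unfolding \<sigma> using Comm.prems(1) by (auto simp: \<tau>_def intro!: weval_tree_cong)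
      then show ?thesis using Comm.prems(4)[of \<tau>] \<tau> weval_Comm[of \<tau> l r] Kc by metis
    qed
    then show "weval G \<rho> (tree_word l) \<in> centralizer_mod G D V"
      using weval_tree_closed[OF Kc[OF \<rho>]] by (simp add: centralizer_mod_def)
  qed (use Comm.prems(1) K normal_centralizer_mod[OF D V conj] in auto)
  then have Vl: "V \<subseteq> centralizer_mod G D (tree_subgroup G K l)"
    using centralizer_mod_sym[OF D _ V] by blast
  have nl: "tree_subgroup G K l \<lhd> G" and nr: "tree_subgroup G K r \<lhd> G"
    using normal_tree_subgroup[of K] K by auto
  have "tree_subgroup G K r \<subseteq> centralizer_mod G D (tree_subgroup G K l)"
    using Comm.prems(1) K normal_centralizer_mod_normal[OF D nl] Vl
    by (intro Comm.IH(2)) (auto simp: V_def)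
  then have "tree_subgroup G K l \<subseteq> centralizer_mod G D (tree_subgroup G K r)"
    using centralizer_mod_sym[OF D] normal_closed(1)[OF nl] by blast
  then show ?case using centralizer_mod_iff[OF D nl] by simp
qed

text \<open>The inductions below descend from a tree to a subtree while replacing the bounding subgroup
  \<open>D\<close> by the centralizer modulo \<open>D\<close> of the other subtree.\<close>

lemma tree_subgroup_Comm_left:
  assumes "disjoint_leaves (Comm l r)" "D \<lhd> G" "\<And>j. K j \<lhd> G" "Z \<lhd> G" "j \<in> leaves l"
    "tree_subgroup G (K(j := Z)) (Comm l r) \<subseteq> D"
  shows "tree_subgroup G (K(j := Z)) l \<subseteq> centralizer_mod G D (tree_subgroup G K r)"
proof -
  have n: "tree_subgroup G (K(j := Z)) l \<lhd> G" using assms(3,4) by (intro normal_tree_subgroup) auto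
  have "j \<notin> leaves r" using assms by auto
  then show ?thesis using assms(6) centralizer_mod_iff[OF assms(2) n] by simp
qed

lemma tree_subgroup_Comm_right:
  assumes "disjoint_leaves (Comm l r)" "D \<lhd> G" "\<And>j. K j \<lhd> G" "Z \<lhd> G" "j \<in> leaves r"
    "tree_subgroup G (K(j := Z)) (Comm l r) \<subseteq> D"
  shows "tree_subgroup G (K(j := Z)) r \<subseteq> centralizer_mod G D (tree_subgroup G K l)"
proof (rule centralizer_mod_sym[OF assms(2)])
  have n: "tree_subgroup G (K(j := Z)) r \<lhd> G" "tree_subgroup G K l \<lhd> G"
    using assms(3,4) by (auto intro!: normal_tree_subgroup)
  then show "tree_subgroup G (K(j := Z)) r \<subseteq> carrier G" using normal_closed(1) by blast
  have "j \<notin> leaves l" using assms by auto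
  then show "tree_subgroup G K l \<subseteq> centralizer_mod G D (tree_subgroup G (K(j := Z)) r)"
    using assms(6) centralizer_mod_iff[OF assms(2) n(2)] by simp
qed

text \<open>Descending to the leaf \<open>i\<close> turns the two bounds into \<open>P\<close> and
  \<open>Q\<close> lying in one normal subgroup, which then contains all products
  \<open>x y\<close>.\<close>

lemma tree_subgroup_split:
  assumes "disjoint_leaves t" "D \<lhd> G" "\<And>j. K j \<lhd> G" "P \<lhd> G" "Q \<lhd> G" "Z \<lhd> G" "i \<in> leaves t"
    "\<And>z. z \<in> Z \<Longrightarrow> \<exists>x\<in>P. \<exists>y\<in>Q. z = x \<otimes> y"
    "tree_subgroup G (K(i := P)) t \<subseteq> D" "tree_subgroup G (K(i := Q)) t \<subseteq> D"
  shows "tree_subgroup G (K(i := Z)) t \<subseteq> D"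
  using assms(1,2,7,9,10)
proof (induction t arbitrary: D)
  case (Leaf v)
  then show ?case using assms(8) normal_closed(3)[OF Leaf(2)] by (fastforce simp: subset_iff)
next
  case (Comm l r)
  note D = Comm.prems(2)
  have nl: "tree_subgroup G K l \<lhd> G" and nr: "tree_subgroup G K r \<lhd> G"
    using normal_tree_subgroup[of K] assms(3) by auto
  have n: "tree_subgroup G (K(i := Z)) t \<lhd> G" for t
    using assms(3,6) by (auto intro!: normal_tree_subgroup)
  show ?case
  proof (cases "i \<in> leaves l")
    case True
    then have "tree_subgroup G (K(i := Z)) l \<subseteq> centralizer_mod G D (tree_subgroup G K r)"
      using Comm.prems normal_centralizer_mod_normal[OF D nr] assms(3-5)
      by (intro Comm.IH(1) tree_subgroup_Comm_left) (auto simp del: fun_upd_apply)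
    moreover have "i \<notin> leaves r" using True Comm.prems(1) by auto
    ultimately show ?thesis using centralizer_mod_iff[OF D n] by (simp del: fun_upd_apply)
  next
    case False
    then have "tree_subgroup G (K(i := Z)) r \<subseteq> centralizer_mod G D (tree_subgroup G K l)"
      using Comm.prems normal_centralizer_mod_normal[OF D nl] assms(3-5)
      by (intro Comm.IH(2) tree_subgroup_Comm_right) (auto simp del: fun_upd_apply)
    then have "tree_subgroup G K l \<subseteq> centralizer_mod G D (tree_subgroup G (K(i := Z)) r)"
      using centralizer_mod_sym[OF D] normal_closed(1)[OF nl] by blast
    then show ?thesis using False centralizer_mod_iff[OF D nl] by (simp del: fun_upd_apply)
  qed
qed

section \<open>Multiplicativity of outer commutator words in each argument\<close>

abbreviation raise where
  "raise K j \<equiv> K(j := commutator_subgroup G (K j) (carrier G))"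

text \<open>The three subgroups lemma is carried from one bracket to a tree: commutation of the
  whole with \<open>g\<close> is controlled by commutation of single leaves with \<open>G\<close>.
  At a node the induction hypotheses say that, modulo \<open>D\<close>, \<open>[l,G]\<close>
  centralizes \<open>r\<close> and \<open>[r,G]\<close> centralizes \<open>l\<close>, which is the
  input of \<open>commutator_central_mod\<close>.\<close>

lemma tree_subgroup_central_mod:
  assumes "disjoint_leaves t" "D \<lhd> G" "\<And>j. K j \<lhd> G"
    "\<And>j. j \<in> leaves t \<Longrightarrow> tree_subgroup G (raise K j) t \<subseteq> D"
    "x \<in> tree_subgroup G K t" "g \<in> carrier G"
  shows "commutator G x g \<in> D"
proof -
  \<comment> \<open>The right-hand side is the preimage of the centre of \<open>G/D\<close>.\<close>
  have "tree_subgroup G K t \<subseteq> centralizer_mod G D (carrier G)"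
    using assms(1,2,4)
  proof (induction t arbitrary: D)
    case (Leaf v)
    then have "commutator_subgroup G (K v) (carrier G) \<subseteq> D" by simp
    then show ?case using centralizer_mod_iff[OF Leaf(2) assms(3)] by simp
  next
    case (Comm l r)
    note D = Comm.prems(2)
    have nl: "tree_subgroup G K l \<lhd> G" and nr: "tree_subgroup G K r \<lhd> G"
      using normal_tree_subgroup[of K] assms(3) by auto
    note nC = normal_commutator_subgroup[OF assms(3) normal_carrier]
    have l: "tree_subgroup G K l \<subseteq> centralizer_mod G (centralizer_mod G D (tree_subgroup G K r)) (carrier G)"
      using Comm.prems normal_centralizer_mod_normal[OF D nr]
      by (intro Comm.IH(1) tree_subgroup_Comm_left[OF _ D assms(3) nC]) (auto simp del: fun_upd_apply)
    have r: "tree_subgroup G K r \<subseteq> centralizer_mod G (centralizer_mod G D (tree_subgroup G K l)) (carrier G)"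
      using Comm.prems normal_centralizer_mod_normal[OF D nl]
      by (intro Comm.IH(2) tree_subgroup_Comm_right[OF _ D assms(3) nC]) (auto simp del: fun_upd_apply)
    have "commutator_subgroup G (tree_subgroup G K l) (tree_subgroup G K r) \<subseteq> centralizer_mod G D (carrier G)"
    proof (rule commutator_subgroup_leI)
      show "subgroup (centralizer_mod G D (carrier G)) G"
        by (intro normal_imp_subgroup normal_centralizer_mod_normal D normal_carrier)
      fix x y assume xy: "x \<in> tree_subgroup G K l" "y \<in> tree_subgroup G K r"
      have "commutator G (commutator G x y) g \<in> D" if "g \<in> carrier G" for g
        using commutator_central_mod[OF D nl nr xy that] centralizer_modD(2) l r by blast
      then show "commutator G x y \<in> centralizer_mod G D (carrier G)"
        using xy normal_closed(1)[OF nl] normal_closed(1)[OF nr] by (simp add: centralizer_mod_def)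
    qed
    then show ?case by simp
  qed
  then show ?thesis using centralizer_modD(2) assms(5,6) by blast
qed

text \<open>A bracket fails to be multiplicative only by further commutators with its values, and
  these lie in \<open>D\<close> by \<open>tree_subgroup_central_mod\<close>. The subtree containing
  \<open>i\<close> is multiplicative modulo the centralizer of the other subtree, and the bracket
  with that subtree turns this into a congruence modulo \<open>D\<close>.\<close>

lemma weval_mult_mod:
  assumes "disjoint_leaves t" "D \<lhd> G" "\<And>j. K j \<lhd> G"
    "\<And>j. j \<in> leaves t \<Longrightarrow> tree_subgroup G (raise K j) t \<subseteq> D"
    "i \<in> leaves t" "\<And>j. \<rho> j \<in> K j" "x \<in> K i" "y \<in> K i"
  shows "cong_mod G D (weval G (\<rho>(i := x)) (tree_word t) \<otimes> weval G (\<rho>(i := y)) (tree_word t))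
    (weval G (\<rho>(i := x \<otimes> y)) (tree_word t))"
  using assms(1,2,4,5)
proof (induction t arbitrary: D)
  case (Leaf v)
  then show ?case
    using normal_closed(2)[OF Leaf(2)] normal_closed(1)[OF assms(3)] assms(7,8) by (simp add: cong_mod_def)
next
  case (Comm l r)
  note D = Comm.prems(2)
  have nl: "tree_subgroup G K l \<lhd> G" and nr: "tree_subgroup G K r \<lhd> G"
    using normal_tree_subgroup[of K] assms(3) by auto
  note nC = normal_commutator_subgroup[OF assms(3) normal_carrier]
  define v where "v = (\<lambda>z t. weval G (\<rho>(i := z)) (tree_word t))"
  have zK: "x \<otimes> y \<in> K i" using normal_closed(3)[OF assms(3)] assms(7,8) by blast
  have v_in: "v z t \<in> tree_subgroup G K t" if "z \<in> K i" for z t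
    unfolding v_def using assms(3,6) that by (intro weval_in_tree_subgroup) auto
  have v_c: "v z t \<in> carrier G" if "z \<in> K i" for z t
    using v_in[OF that] normal_closed(1)[OF normal_tree_subgroup] assms(3) by blast
  have v_Comm: "weval G (\<rho>(i := z)) (tree_word (Comm l r)) = commutator G (v z l) (v z r)"
    if "z \<in> K i" for z
  proof -
    have "(\<rho>(i := z)) j \<in> carrier G" for j
      using that assms(6) normal_closed(1)[OF assms(3)] by (metis fun_upd_apply)
    then show ?thesis unfolding v_def by (rule weval_Comm)
  qed
  have central: "commutator G (commutator G (v z l) (v z' r)) g \<in> D"
    if "z \<in> K i" "z' \<in> K i" "g \<in> carrier G" for z z' g
  proof (rule tree_subgroup_central_mod[OF Comm.prems(1) D assms(3) Comm.prems(3) _ that(3)])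
    show "commutator G (v z l) (v z' r) \<in> tree_subgroup G K (Comm l r)"
      using commutator_in_commutator_subgroup v_in that by auto
  qed
  \<comment> \<open>In both cases below, congruence \<open>1\<close> comes from the induction
    hypothesis inside the subtree and \<open>2\<close> from expanding the outer bracket.\<close>
  note c = v_c[OF assms(7)] v_c[OF assms(8)] v_c[OF zK]
  show ?case
  proof (cases "i \<in> leaves l")
    case True
    define h where "h = weval G \<rho> (tree_word r)"
    have "i \<notin> leaves r" using True Comm.prems(1) by auto
    then have vr: "v z r = h" for z by (simp add: v_def h_def)
    have h: "h \<in> tree_subgroup G K r" using v_in[OF zK, of r] by (simp add: vr)
    have hc: "h \<in> carrier G" using c(1)[of r] by (simp add: vr)
    have "cong_mod G (centralizer_mod G D (tree_subgroup G K r)) (v x l \<otimes> v y l) (v (x \<otimes> y) l)"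
      unfolding v_def using Comm.prems normal_centralizer_mod_normal[OF D nr] True
      by (intro Comm.IH(1) tree_subgroup_Comm_left[OF _ D assms(3) nC]) (auto simp del: fun_upd_apply)
    then have 1: "cong_mod G D (commutator G (v x l \<otimes> v y l) h) (commutator G (v (x \<otimes> y) l) h)"
      using c by (intro commutator_cong_left[OF D nr h]) auto
    have 2: "cong_mod G D (commutator G (v x l) h \<otimes> commutator G (v y l) h) (commutator G (v x l \<otimes> v y l) h)"
      using central[OF assms(7) assms(7) c(2)] c hc by (intro commutator_mult_left_mod[OF D]) (auto simp: vr)
    show ?thesis
      unfolding v_Comm[OF assms(7)] v_Comm[OF assms(8)] v_Comm[OF zK] vr
      using c hc by (intro cong_mod_trans[OF D 2 1]) auto
  next
    case False
    then have True: "i \<in> leaves r" using Comm.prems(4) by simp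
    define h where "h = weval G \<rho> (tree_word l)"
    have vl: "v z l = h" for z using False by (simp add: v_def h_def)
    have h: "h \<in> tree_subgroup G K l" using v_in[OF zK, of l] by (simp add: vl)
    have hc: "h \<in> carrier G" using c(1)[of l] by (simp add: vl)
    have "cong_mod G (centralizer_mod G D (tree_subgroup G K l)) (v x r \<otimes> v y r) (v (x \<otimes> y) r)"
      unfolding v_def using Comm.prems normal_centralizer_mod_normal[OF D nl] True
      by (intro Comm.IH(2) tree_subgroup_Comm_right[OF _ D assms(3) nC]) (auto simp del: fun_upd_apply)
    then have 1: "cong_mod G D (commutator G h (v x r \<otimes> v y r)) (commutator G h (v (x \<otimes> y) r))"
      using c by (intro commutator_cong_right[OF D nl h]) auto
    have 2: "cong_mod G D (commutator G h (v x r) \<otimes> commutator G h (v y r)) (commutator G h (v x r \<otimes> v y r))"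
      using central[OF assms(7) assms(7)] c hc by (intro commutator_mult_right_mod[OF D]) (auto simp: vl)
    show ?thesis
      unfolding v_Comm[OF assms(7)] v_Comm[OF assms(8)] v_Comm[OF zK] vl
      using c hc by (intro cong_mod_trans[OF D 2 1]) auto
  qed
qed

text \<open>At the leaf the two values differ by \<open>a\<close>, which lies in \<open>N\<close>;
  the commutator congruences carry this up the tree. The inclusion of \<open>N\<close> in
  \<open>K i\<close> keeps the changed entry inside \<open>K i\<close>.\<close>

lemma weval_cong_mod:
  assumes "disjoint_leaves t" "D \<lhd> G" "\<And>j. K j \<lhd> G" "N \<lhd> G" "N \<subseteq> K i"
    "tree_subgroup G (K(i := N)) t \<subseteq> D" "i \<in> leaves t" "\<And>j. \<rho> j \<in> K j" "a \<in> N"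
  shows "cong_mod G D (weval G \<rho> (tree_word t)) (weval G (\<rho>(i := \<rho> i \<otimes> a)) (tree_word t))"
  using assms(1,2,6,7)
proof (induction t arbitrary: D)
  case (Leaf v)
  have "\<rho> i \<in> carrier G" "a \<in> carrier G" "a \<in> D"
    using Leaf normal_closed(1)[OF assms(3) assms(8)] normal_closed(1)[OF assms(4)] assms(9) by auto
  then show ?case using Leaf by (simp add: cong_mod_def inv_cancel_left)
next
  case (Comm l r)
  note D = Comm.prems(2)
  have nl: "tree_subgroup G K l \<lhd> G" and nr: "tree_subgroup G K r \<lhd> G"
    using normal_tree_subgroup[of K] assms(3) by auto
  define \<sigma> where "\<sigma> = \<rho>(i := \<rho> i \<otimes> a)"
  have \<sigma>: "\<sigma> j \<in> K j" for j
    using assms(5,8,9) normal_closed(3)[OF assms(3)] by (auto simp: \<sigma>_def)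
  have c: "\<rho> j \<in> carrier G" "\<sigma> j \<in> carrier G" for j
    using normal_closed(1)[OF assms(3)] assms(8) \<sigma> by auto
  have wc: "weval G \<rho> (tree_word t) \<in> carrier G" "weval G \<sigma> (tree_word t) \<in> carrier G" for t
    using c by auto
  have w_in: "weval G \<rho> (tree_word t) \<in> tree_subgroup G K t" for t
    using assms(3,8) by (rule weval_in_tree_subgroup)
  show ?case
  proof (cases "i \<in> leaves l")
    case True
    have "i \<notin> leaves r" using True Comm.prems(1) by auto
    then have e: "weval G \<sigma> (tree_word r) = weval G \<rho> (tree_word r)" by (simp add: \<sigma>_def)
    have "cong_mod G (centralizer_mod G D (tree_subgroup G K r)) (weval G \<rho> (tree_word l)) (weval G \<sigma> (tree_word l))"
      unfolding \<sigma>_def using Comm.prems normal_centralizer_mod_normal[OF D nr] True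
      by (intro Comm.IH(1) tree_subgroup_Comm_left[OF _ D assms(3,4)]) (auto simp del: fun_upd_apply)
    from commutator_cong_left[OF D nr w_in wc this]
    show ?thesis unfolding \<sigma>_def[symmetric] weval_Comm[OF c(1)] weval_Comm[OF c(2)] e .
  next
    case False
    then have True: "i \<in> leaves r" using Comm.prems(4) by simp
    have e: "weval G \<sigma> (tree_word l) = weval G \<rho> (tree_word l)" using False by (simp add: \<sigma>_def)
    have "cong_mod G (centralizer_mod G D (tree_subgroup G K l)) (weval G \<rho> (tree_word r)) (weval G \<sigma> (tree_word r))"
      unfolding \<sigma>_def using Comm.prems normal_centralizer_mod_normal[OF D nl] True
      by (intro Comm.IH(2) tree_subgroup_Comm_right[OF _ D assms(3,4)]) (auto simp del: fun_upd_apply)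
    from commutator_cong_right[OF D nl w_in wc this]
    show ?thesis unfolding \<sigma>_def[symmetric] weval_Comm[OF c(1)] weval_Comm[OF c(2)] e .
  qed
qed

section \<open>Outer commutator words and marginal subgroups\<close>

lemma weval_eq_one_of_marginal:
  assumes "i \<in> leaves t" "\<And>j. \<rho> j \<in> carrier G" "\<rho> i \<in> marginal {tree_word t} G"
  shows "weval G \<rho> (tree_word t) = \<one>"
proof -
  \<comment> \<open>A marginal entry may be replaced by the neutral element, at which the word
    vanishes.\<close>
  define \<sigma> where "\<sigma> = \<rho>(i := \<one>)"
  have \<sigma>: "\<sigma> j \<in> carrier G" for j using assms(2) by (simp add: \<sigma>_def)
  have "\<sigma>(i := \<sigma> i \<otimes> \<rho> i) = \<rho>" using assms(2) by (auto simp: \<sigma>_def)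
  then have "weval G \<rho> (tree_word t) = weval G \<sigma> (tree_word t)"
    using marginalD[OF assms(3), of "tree_word t" \<sigma> i] \<sigma> by simp
  also have "\<dots> = \<one>" using \<sigma> assms(1) by (rule weval_tree_one) (simp add: \<sigma>_def)
  finally show ?thesis .
qed

lemma tree_subgroup_marginal:
  assumes "disjoint_leaves t" "\<And>j. K j \<lhd> G" "i \<in> leaves t" "K i \<subseteq> marginal {tree_word t} G"
  shows "tree_subgroup G K t \<subseteq> {\<one>}"
proof (rule tree_subgroup_leI[OF assms(1) normal_trivial assms(2)])
  fix \<rho> assume \<rho>: "\<And>j. \<rho> j \<in> K j"
  have "\<rho> j \<in> carrier G" for j using normal_closed(1)[OF assms(2) \<rho>] .
  then show "weval G \<rho> (tree_word t) \<in> {\<one>}"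
    using weval_eq_one_of_marginal[OF assms(3)] \<rho> assms(4) by blast
qed

text \<open>Together with \<open>tree_subgroup_marginal\<close> this characterizes marginality of a
  normal subgroup by the vanishing of subgroups \<open>tree_subgroup\<close>.\<close>

lemma subset_marginal_tree_word:
  fixes t :: "'v comm_tree"
  assumes "disjoint_leaves t" "N \<lhd> G"
    "\<And>i. i \<in> leaves t \<Longrightarrow> tree_subgroup G ((\<lambda>_. carrier G)(i := N)) t \<subseteq> {\<one>}"
  shows "N \<subseteq> marginal {tree_word t} G"
proof
  fix a assume a: "a \<in> N"
  then have ac: "a \<in> carrier G" using normal_closed(1)[OF assms(2)] by blast
  show "a \<in> marginal {tree_word t} G"
  proof (rule marginalI[OF ac])
    fix v and \<rho> :: "'v \<Rightarrow> 'a" and i assume v: "v \<in> {tree_word t}" and \<rho>: "\<And>j. \<rho> j \<in> carrier G"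
    show "weval G (\<rho>(i := \<rho> i \<otimes> a)) v = weval G \<rho> v"
    proof (cases "i \<in> leaves t")
      case True
      have N: "N \<subseteq> carrier G" using normal_closed(1)[OF assms(2)] by blast
      have "cong_mod G {\<one>} (weval G \<rho> (tree_word t)) (weval G (\<rho>(i := \<rho> i \<otimes> a)) (tree_word t))"
        by (rule weval_cong_mod[OF assms(1) normal_trivial normal_carrier assms(2) N assms(3)[OF True] True \<rho> a])
      moreover have "weval G \<rho> (tree_word t) \<in> carrier G" "weval G (\<rho>(i := \<rho> i \<otimes> a)) (tree_word t) \<in> carrier G"
        using \<rho> ac by auto
      ultimately show ?thesis using v cong_mod_trivial by simp
    next
      case False
      then show ?thesis using v by simp
    qed
  qed
qed

lemma eq_one_if_coprime_powers:
  assumes "x \<in> carrier G" "x [^] (a::nat) = \<one>" "x [^] (b::nat) = \<one>" "coprime a b"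
  shows "x = \<one>"
proof -
  have "ord x dvd a" "ord x dvd b" using assms pow_eq_id by auto
  then have "ord x = 1" using assms(4) coprime_common_divisor_nat by blast
  then show ?thesis using assms(1) ord_eq_1 by simp
qed

text \<open>If every raised family gives the trivial subgroup, the word is multiplicative in each leaf, so
  its values have order dividing both \<open>a\<close> and \<open>b\<close>. This permits a descending induction along the
  central series \<open>L\<close>.\<close>

lemma tree_subgroup_mixed:
  fixes t :: "'v comm_tree" and L :: "nat \<Rightarrow> 'a set" and a b :: nat
  assumes t: "disjoint_leaves t"
    and L: "\<And>k. subgroup (L k) G" "\<And>k u g. u \<in> L k \<Longrightarrow> g \<in> carrier G \<Longrightarrow> commutator G u g \<in> L (Suc k)"
      "L c \<subseteq> marginal {tree_word t} G"
    and a: "\<And>x. x \<in> P \<Longrightarrow> x [^] a \<in> marginal {tree_word t} G"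
    and b: "\<And>y. y \<in> Q \<Longrightarrow> y [^] b \<in> marginal {tree_word t} G"
    and ab: "coprime a b"
    and pq: "p \<in> leaves t" "q \<in> leaves t"
    and K: "\<And>j. K j \<lhd> G" "\<And>j. j \<in> leaves t \<Longrightarrow> K j \<subseteq> L (k j)" "\<And>j. j \<in> leaves t \<Longrightarrow> k j \<le> c"
      "K p \<subseteq> P" "K q \<subseteq> Q"
  shows "tree_subgroup G K t \<subseteq> {\<one>}"
  using K
\<comment> \<open>\<open>k j\<close> is a depth in the series at which \<open>K j\<close> is known
  to lie, and the measure adds up the distances left to \<open>c\<close>. Each \<open>raise\<close>
  shortens one of them. Once some distance is zero, that argument is marginal.\<close>
proof (induction "\<Sum>j\<in>leaves t. c - k j" arbitrary: K k rule: less_induct)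
  case less
  note K = less.prems(1)
  show ?case
  proof (cases "\<exists>j\<in>leaves t. k j = c")
    case True
    then obtain j where j: "j \<in> leaves t" "k j = c" by blast
    show ?thesis
      by (rule tree_subgroup_marginal[where K = K, OF t K j(1)]) (use less.prems(2)[OF j(1)] L(3) j(2) in auto)
  next
    case False
    have raise: "tree_subgroup G (raise K j) t \<subseteq> {\<one>}" if j: "j \<in> leaves t" for j
    proof (rule less.hyps)
      have kj: "k j < c" using False j less.prems(3)[OF j] by fastforce
      show "(\<Sum>i\<in>leaves t. c - (k(j := Suc (k j))) i) < (\<Sum>i\<in>leaves t. c - k i)"
        using kj j by (intro sum_strict_mono_ex1) auto
      show "raise K j i \<lhd> G" for i
        using K normal_commutator_subgroup[OF K normal_carrier] by simp
      show "raise K j i \<subseteq> L ((k(j := Suc (k j))) i)" if "i \<in> leaves t" for i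
      proof (cases "i = j")
        case True
        have "commutator_subgroup G (K j) (carrier G) \<subseteq> L (Suc (k j))"
          by (rule commutator_subgroup_leI[OF L(1) L(2)]) (use less.prems(2)[OF j] in auto)
        then show ?thesis using True by simp
      qed (use less.prems(2)[OF that] in simp)
      show "(k(j := Suc (k j))) i \<le> c" if "i \<in> leaves t" for i
        using kj less.prems(3)[OF that] by simp
      have "commutator_subgroup G (K j) (carrier G) \<subseteq> K j"
        by (rule commutator_subgroup_leI[OF normal_imp_subgroup[OF K] normal_commutator_left[OF K]])
      then have "raise K j i \<subseteq> K i" for i by simp
      then show "raise K j p \<subseteq> P" "raise K j q \<subseteq> Q" using less.prems(4,5) by blast+
    qed
    show ?thesis
    proof (rule tree_subgroup_leI[OF t normal_trivial K])
      fix \<rho> assume \<rho>: "\<And>j. \<rho> j \<in> K j"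
      then have \<rho>c: "\<rho> j \<in> carrier G" for j using normal_closed(1)[OF K] by blast
      have vc: "weval G \<rho> (tree_word t) \<in> carrier G" using \<rho>c by simp
      have pow_in: "\<rho> i [^] n \<in> K i" for i and n :: nat
        by (induction n) (auto intro: normal_closed[OF K] \<rho>)
      \<comment> \<open>Multiplicativity at leaf \<open>i\<close> turns powers of the value into
        powers of the entry. Leaf \<open>p\<close> then yields the exponent \<open>a\<close>, and
        leaf \<open>q\<close> the exponent \<open>b\<close>.\<close>
      have pow: "weval G \<rho> (tree_word t) [^] n = weval G (\<rho>(i := \<rho> i [^] n)) (tree_word t)"
        if i: "i \<in> leaves t" for i and n :: nat
      proof (induction n)
        case 0
        have "weval G (\<rho>(i := \<one>)) (tree_word t) = \<one>" using i \<rho>c by (intro weval_tree_one) auto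
        then show ?case by (simp del: fun_upd_apply)
      next
        case (Suc n)
        have "cong_mod G {\<one>} (weval G (\<rho>(i := \<rho> i [^] n)) (tree_word t) \<otimes> weval G (\<rho>(i := \<rho> i)) (tree_word t))
          (weval G (\<rho>(i := \<rho> i [^] n \<otimes> \<rho> i)) (tree_word t))"
          by (rule weval_mult_mod[OF t normal_trivial K raise i \<rho> pow_in \<rho>])
        moreover have "weval G (\<rho>(i := \<rho> i [^] n)) (tree_word t) \<in> carrier G"
          "weval G (\<rho>(i := \<rho> i [^] n \<otimes> \<rho> i)) (tree_word t) \<in> carrier G"
          using \<rho>c by auto
        ultimately show ?case using Suc vc cong_mod_trivial by (simp del: fun_upd_apply)
      qed
      have pow_one: "weval G \<rho> (tree_word t) [^] n = \<one>"
        if "i \<in> leaves t" "\<rho> i [^] n \<in> marginal {tree_word t} G" for i and n :: nat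
        unfolding pow[OF that(1)] using that \<rho>c by (intro weval_eq_one_of_marginal[of i]) auto
      have "weval G \<rho> (tree_word t) = \<one>"
        using eq_one_if_coprime_powers[OF vc pow_one[OF pq(1)] pow_one[OF pq(2)] ab]
          a b \<rho> less.prems(4,5) by blast
      then show "weval G \<rho> (tree_word t) \<in> {\<one>}" by simp
    qed
  qed
qed

section \<open>The marginal subgroup of a factor\<close>

lemma weval_subgroup:
  assumes "subgroup H G" "\<And>j. \<rho> j \<in> H"
  shows "weval (G\<lparr>carrier := H\<rparr>) \<rho> w = weval G \<rho> w"
proof -
  have H: "group (G\<lparr>carrier := H\<rparr>)" using assms(1) subgroup_imp_group by blast
  have "group_hom (G\<lparr>carrier := H\<rparr>) G (\<lambda>x. x)"
    using H is_group subgroup.mem_carrier[OF assms(1)]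
    by (auto simp: group_hom_def group_hom_axioms_def hom_def)
  from weval_hom[OF this, of \<rho> w] assms(2) show ?thesis by (simp add: comp_def)
qed

text \<open>The inclusion of \<open>marginal {tree_word t} G\<close> holds by restricting
  assignments to \<open>P\<close>. For the other one, each argument \<open>G\<close> is split into
  \<open>P\<close> and \<open>Q\<close>: families with some \<open>Q\<close> vanish by coprimality,
  families inside \<open>P\<close> by marginality in \<open>P\<close>.\<close>

theorem marginal_factor:
  fixes t :: "'v comm_tree" and L :: "nat \<Rightarrow> 'a set" and a b :: nat
  assumes t: "disjoint_leaves t"
    and L: "\<And>k. subgroup (L k) G" "\<And>k u g. u \<in> L k \<Longrightarrow> g \<in> carrier G \<Longrightarrow> commutator G u g \<in> L (Suc k)"
      "L 0 = carrier G" "L c \<subseteq> marginal {tree_word t} G"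
    and a: "\<And>x. x \<in> P \<Longrightarrow> x [^] a \<in> marginal {tree_word t} G"
    and b: "\<And>y. y \<in> Q \<Longrightarrow> y [^] b \<in> marginal {tree_word t} G"
    and ab: "coprime a b"
    and PQ: "P \<lhd> G" "Q \<lhd> G" "marginal {tree_word t} G \<subseteq> P" "P \<inter> Q \<subseteq> marginal {tree_word t} G"
      "\<And>g. g \<in> carrier G \<Longrightarrow> \<exists>x\<in>P. \<exists>y\<in>Q. g = x \<otimes> y"
  shows "marginal {tree_word t} (G\<lparr>carrier := P\<rparr>) = marginal {tree_word t} G"
proof
  let ?H = "G\<lparr>carrier := P\<rparr>"
  let ?N = "marginal {tree_word t} ?H" and ?M = "marginal {tree_word t} G"
  have sP: "subgroup P G" using PQ(1) by (rule normal_imp_subgroup)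
  interpret H: group ?H using sP subgroup_imp_group by blast
  have Pc: "x \<in> carrier G" if "x \<in> P" for x using normal_closed(1)[OF PQ(1) that] .
  have invH: "inv\<^bsub>?H\<^esub> x = inv x" if "x \<in> P" for x using m_inv_consistent[OF sP that] .
  have NP: "?N \<subseteq> P" by (auto simp: marginal_def)
  have NH: "?N \<lhd> ?H" using H.group_axioms by (rule marginal_normal)
  show MN: "?M \<subseteq> ?N"
  proof
    fix m assume m: "m \<in> ?M"
    then have mP: "m \<in> P" using PQ(3) by blast
    show "m \<in> ?N"
    proof (rule marginalI)
      show "m \<in> carrier ?H" using mP by simp
      fix v and \<rho> :: "'v \<Rightarrow> 'a" and i
      assume v: "v \<in> {tree_word t}" and "\<And>j. \<rho> j \<in> carrier ?H"
      then have \<rho>: "\<rho> j \<in> P" for j by simp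
      then have "(\<rho>(i := \<rho> i \<otimes> m)) j \<in> P" for j using mP normal_closed(3)[OF PQ(1)] by simp
      then show "weval ?H (\<rho>(i := \<rho> i \<otimes>\<^bsub>?H\<^esub> m)) v = weval ?H \<rho> v"
        using marginalD[OF m v, of \<rho> i] \<rho> Pc by (simp add: weval_subgroup[OF sP])
    qed
  qed
  have N: "?N \<lhd> G"
  proof (rule normalI_closed)
    show "?N \<subseteq> carrier G" using NP Pc by blast
    show "\<one> \<in> ?N" using H.normal_closed(2)[OF NH] by simp
    show "x \<otimes> y \<in> ?N" if "x \<in> ?N" "y \<in> ?N" for x y using H.normal_closed(3)[OF NH that] by simp
    show "inv x \<in> ?N" if "x \<in> ?N" for x using H.normal_closed(4)[OF NH that] invH that NP by auto
    \<comment> \<open>With \<open>g = x y\<close>, conjugation by \<open>y\<close> multiplies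
      \<open>n\<close> by a commutator in both \<open>P\<close> and \<open>Q\<close>, hence in the
      marginal subgroup of \<open>G\<close>. Conjugation by \<open>x\<close> stays inside
      \<open>P\<close>, where \<open>?N\<close> is normal.\<close>
    fix n g assume n: "n \<in> ?N" and g: "g \<in> carrier G"
    obtain x y where xy: "x \<in> P" "y \<in> Q" "g = x \<otimes> y" using PQ(5)[OF g] by blast
    have c: "n \<in> carrier G" "x \<in> carrier G" "y \<in> carrier G"
      using n NP Pc xy normal_closed(1)[OF PQ(2)] by auto
    have "commutator G n (inv y) \<in> P \<inter> Q"
      using normal_commutator_left[OF PQ(1)] normal_commutator_right[OF PQ(2)] n NP c xy
        normal_closed(4)[OF PQ(2)] by auto
    then have "commutator G n (inv y) \<in> ?N" using PQ(4) MN by blast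
    then have "n \<otimes> commutator G n (inv y) \<in> ?N" using H.normal_closed(3)[OF NH n] by simp
    then have "y \<otimes> n \<otimes> inv y \<in> ?N" using conj_eq_mult_commutator[OF c(1,3)] by simp
    then have "x \<otimes> (y \<otimes> n \<otimes> inv y) \<otimes> inv x \<in> ?N"
      using H.normal_conj(1)[OF NH, of _ x] invH xy(1) by simp
    moreover have "x \<otimes> (y \<otimes> n \<otimes> inv y) \<otimes> inv x = g \<otimes> n \<otimes> inv g"
      using c xy(3) by (simp add: m_assoc inv_mult_group)
    ultimately show "g \<otimes> n \<otimes> inv g \<in> ?N" by simp
  qed
  \<comment> \<open>\<open>S\<close> collects the leaves still carrying the whole group; each
    induction step splits one of them.\<close>
  have all: "tree_subgroup G K t \<subseteq> {\<one>}"
    if "finite S" "i \<in> leaves t" "i \<notin> S" "S \<subseteq> leaves t" "\<And>j. K j \<lhd> G" "K i = ?N"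
      "\<And>j. j \<in> leaves t - S - {i} \<Longrightarrow> K j = P \<or> K j = Q" "\<And>j. j \<in> S \<Longrightarrow> K j = carrier G"
    for S i K
    using that
  proof (induction S arbitrary: K rule: finite_induct)
    case empty
    note K = empty.prems(4)
    have Kc: "K j \<subseteq> carrier G" for j using normal_closed(1)[OF K] by blast
    show ?case
    proof (cases "\<exists>q\<in>leaves t. K q = Q")
      case True
      then obtain q where q: "q \<in> leaves t" "K q = Q" by blast
      \<comment> \<open>Leaf \<open>i\<close> serves as the argument inside \<open>P\<close>, since
        \<open>?N\<close> lies in \<open>P\<close>. Depth 0 is available at every leaf because
        \<open>L 0\<close> is the whole group.\<close>
      show ?thesis
        by (rule tree_subgroup_mixed[OF t L(1) L(2) L(4) a b ab empty.prems(1) q(1) K, where k = "\<lambda>_. 0"])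
          (use Kc L(3) NP q empty.prems(5) in auto)
    next
      case False
      then have KP: "K j \<subseteq> P" if "j \<in> leaves t" for j
        using that empty.prems NP by (cases "j = i") auto
      show ?thesis
      proof (rule tree_subgroup_leI[OF t normal_trivial K])
        fix \<rho> assume \<rho>: "\<And>j. \<rho> j \<in> K j"
        \<comment> \<open>Away from the leaves the values of \<open>\<rho>\<close> may leave
          \<open>P\<close>, so they are reset before the word is evaluated in the subgroup.\<close>
        define \<sigma> where "\<sigma> = (\<lambda>j. if j \<in> leaves t then \<rho> j else \<one>)"
        have \<sigma>: "\<sigma> j \<in> P" for j using \<rho> KP normal_closed(2)[OF PQ(1)] by (auto simp: \<sigma>_def)
        have "weval G \<rho> (tree_word t) = weval G \<sigma> (tree_word t)"
          by (rule weval_tree_cong) (simp add: \<sigma>_def)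
        also have "\<dots> = weval ?H \<sigma> (tree_word t)" using weval_subgroup[where \<rho> = \<sigma>, OF sP \<sigma>] by simp
        also have "\<dots> = \<one>"
          using H.weval_eq_one_of_marginal[OF empty.prems(1), of \<sigma>] \<sigma> \<rho>[of i] empty.prems(1,5)
          by (simp add: \<sigma>_def)
        finally show "weval G \<rho> (tree_word t) \<in> {\<one>}" by simp
      qed
    qed
  next
    case (insert s S)
    have IH: "tree_subgroup G (K(s := Z)) t \<subseteq> {\<one>}" if "Z = P \<or> Z = Q" for Z
      by (rule insert.IH) (use insert.prems insert.hyps(2) PQ(1,2) that in auto)
    have "tree_subgroup G (K(s := carrier G)) t \<subseteq> {\<one>}"
    proof (rule tree_subgroup_split[OF t normal_trivial insert.prems(4) PQ(1,2) normal_carrier _ PQ(5)])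
      show "s \<in> leaves t" using insert by blast
      show "tree_subgroup G (K(s := P)) t \<subseteq> {\<one>}" "tree_subgroup G (K(s := Q)) t \<subseteq> {\<one>}"
        by (rule IH; simp)+
    qed
    moreover have "K(s := carrier G) = K" using insert.prems(7)[of s] by (auto simp: fun_eq_iff)
    ultimately show ?case by simp
  qed
  show "?N \<subseteq> ?M"
  proof (rule subset_marginal_tree_word[OF t N])
    show "tree_subgroup G ((\<lambda>_. carrier G)(i := ?N)) t \<subseteq> {\<one>}" if "i \<in> leaves t" for i
      by (rule all[of "leaves t - {i}" i]) (use that N normal_carrier in auto)
  qed
qed

end

section \<open>The lower central series\<close>

lemma lower_central_Suc:
  "lower_central G (Suc k) = commutator_subgroup G (lower_central G k) (carrier G)"
  unfolding commutator_subgroup_def commutator_def by simp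

declare lower_central.simps(2) [simp del]

lemma (in group_hom) commutator_hom:
  assumes "x \<in> carrier G" "y \<in> carrier G"
  shows "h (commutator G x y) = commutator H (h x) (h y)"
  using assms by (simp add: commutator_def)

lemma (in group_hom) subgroup_vimage:
  assumes "subgroup D H"
  shows "subgroup {x \<in> carrier G. h x \<in> D} G"
proof -
  interpret D: subgroup D H by fact
  show ?thesis by (rule G.subgroupI) auto
qed

context group
begin

lemma normal_lower_central: "lower_central G k \<lhd> G"
proof (induction k)
  case (Suc k)
  then show ?case unfolding lower_central_Suc by (intro normal_commutator_subgroup normal_carrier)
qed (simp add: normal_carrier)

lemma commutator_in_lower_central:
  "x \<in> lower_central G k \<Longrightarrow> y \<in> carrier G \<Longrightarrow> commutator G x y \<in> lower_central G (Suc k)"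
  unfolding lower_central_Suc by (rule commutator_in_commutator_subgroup)

section \<open>Exponents of nilpotent groups\<close>

lemma pow_order_abelianization:
  assumes "finite (carrier (abelianization G))" "x \<in> carrier G"
  shows "x [^] order (abelianization G) \<in> lower_central G 1"
proof -
  define D where "D = derived G (carrier G)"
  have D: "D \<lhd> G" unfolding D_def by (rule derived_self_is_normal)
  have ab: "abelianization G = G Mod D" by (simp add: abelianization_def D_def)
  interpret D: normal D G by fact
  interpret Q: group "G Mod D" by (rule D.factorgroup_is_group)
  have x: "D #> x \<in> carrier (G Mod D)" using assms(2) by (auto simp: carrier_FactGroup)
  have "(D #> x) [^]\<^bsub>G Mod D\<^esub> order (G Mod D) = \<one>\<^bsub>G Mod D\<^esub>"
    using Q.pow_order_eq_1[OF x] .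
  then have "D #> (x [^] order (G Mod D)) = D"
    using D.FactGroup_pow[OF assms(2)] by simp
  then have "x [^] order (G Mod D) \<in> D"
    using coset_join1 assms(2) D.subgroup_axioms by simp
  \<comment> \<open>\<open>derived\<close> uses the commutator convention with the inverses last,
    which amounts to \<open>[inv x, inv y]\<close> here. Index 1 is the second term of the
    series.\<close>
  moreover have "D \<subseteq> lower_central G 1"
    unfolding D_def derived_def
  proof (rule generate_subgroup_incl)
    show "subgroup (lower_central G 1) G" by (rule normal_imp_subgroup[OF normal_lower_central])
    show "(\<Union>h1\<in>carrier G. \<Union>h2\<in>carrier G. {h1 \<otimes> h2 \<otimes> inv h1 \<otimes> inv h2}) \<subseteq> lower_central G 1"
    proof clarify
      fix x y assume c: "x \<in> carrier G" "y \<in> carrier G"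
      then have "x \<otimes> y \<otimes> inv x \<otimes> inv y = commutator G (inv x) (inv y)" by (simp add: commutator_def)
      then show "x \<otimes> y \<otimes> inv x \<otimes> inv y \<in> lower_central G 1"
        using commutator_in_lower_central[of "inv x" 0 "inv y"] c by simp
    qed
  qed
  ultimately show ?thesis by (auto simp: ab)
qed

text \<open>The image of \<open>x\<close> in \<open>G/D\<close> is central, so powers distribute
  there.\<close>

lemma pow_mult_mod:
  assumes "D \<lhd> G" "x \<in> carrier G" "y \<in> carrier G"
    "\<And>g. g \<in> carrier G \<Longrightarrow> commutator G x g \<in> D"
  shows "cong_mod G D (x [^] (n::nat) \<otimes> y [^] n) ((x \<otimes> y) [^] n)"
proof -
  note D = assms(1)
  interpret D: normal D G by fact
  interpret Q: group "G Mod D" by (rule D.factorgroup_is_group)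
  have h: "group_hom G (G Mod D) ((#>) D)"
    using D.r_coset_hom_Mod is_group Q.is_group by (simp add: group_hom_def group_hom_axioms_def)
  interpret h: group_hom G "G Mod D" "(#>) D" by fact
  have D1: "D #> u = \<one>\<^bsub>G Mod D\<^esub> \<longleftrightarrow> u \<in> D" if "u \<in> carrier G" for u
    using coset_join1[OF _ that D.subgroup_axioms] coset_join2[OF that D.subgroup_axioms] by auto
  have "D #> (x \<otimes> y) = D #> (y \<otimes> x)"
  proof -
    have "x \<otimes> y = y \<otimes> x \<otimes> commutator G x y" using assms by (simp add: group_word_simps)
    then have "D #> (x \<otimes> y) = (D #> (y \<otimes> x)) \<otimes>\<^bsub>G Mod D\<^esub> (D #> commutator G x y)"
      by (rule ssubst[where P = "\<lambda>z. D #> z = _"], intro h.hom_mult) (use assms in auto)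
    also have "D #> commutator G x y = \<one>\<^bsub>G Mod D\<^esub>" using assms D1 by simp
    finally show ?thesis using Q.r_one[OF h.hom_closed[of "y \<otimes> x"]] assms(2,3) by simp
  qed
  then have comm: "(D #> x) \<otimes>\<^bsub>G Mod D\<^esub> (D #> y) = (D #> y) \<otimes>\<^bsub>G Mod D\<^esub> (D #> x)"
    unfolding h.hom_mult[OF assms(2,3), symmetric] h.hom_mult[OF assms(3,2), symmetric] .
  have "D #> ((x \<otimes> y) [^] n) = ((D #> x) \<otimes>\<^bsub>G Mod D\<^esub> (D #> y)) [^]\<^bsub>G Mod D\<^esub> n"
    unfolding h.hom_mult[OF assms(2,3), symmetric] using assms by (intro h.hom_nat_pow) auto
  also have "\<dots> = (D #> x) [^]\<^bsub>G Mod D\<^esub> n \<otimes>\<^bsub>G Mod D\<^esub> (D #> y) [^]\<^bsub>G Mod D\<^esub> n"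
    by (rule Q.pow_mult_distrib[OF comm h.hom_closed h.hom_closed]) (use assms in auto)
  also have "\<dots> = D #> (x [^] n \<otimes> y [^] n)"
    unfolding h.hom_nat_pow[OF assms(2), symmetric] h.hom_nat_pow[OF assms(3), symmetric]
    using assms by (intro h.hom_mult[symmetric]) auto
  finally have e: "D #> ((x \<otimes> y) [^] n) = D #> (x [^] n \<otimes> y [^] n)" .
  let ?z = "x [^] n \<otimes> y [^] n" and ?w = "(x \<otimes> y) [^] n"
  have c: "?z \<in> carrier G" "?w \<in> carrier G" using assms by auto
  have "D #> (inv ?z \<otimes> ?w) = (D #> inv ?z) \<otimes>\<^bsub>G Mod D\<^esub> (D #> ?w)"
    using c by (intro h.hom_mult) auto
  also have "\<dots> = D #> (inv ?z \<otimes> ?z)" unfolding e using c by (intro h.hom_mult[symmetric]) auto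
  finally show ?thesis unfolding cong_mod_def
    using D1[of "inv ?z \<otimes> ?w"] D1[of \<one>] c normal_closed(2)[OF D] by simp
qed

text \<open>Expanding \<open>[x^n x, g]\<close> produces the middle factor
  \<open>[[x^n,g],x]\<close>. It lies in \<open>D\<close> because, by induction,
  \<open>[x^n,g]\<close> agrees modulo \<open>D\<close> with a power of \<open>[x,g]\<close>, which
  is central there.\<close>

lemma commutator_pow_mod:
  assumes D: "D \<lhd> G" and c: "x \<in> carrier G" "g \<in> carrier G"
    and central: "\<And>h. h \<in> carrier G \<Longrightarrow> commutator G (commutator G x g) h \<in> D"
  shows "cong_mod G D (commutator G x g [^] (n::nat)) (commutator G (x [^] n) g)"
proof (induction n)
  case 0
  then show ?case using c normal_closed(2)[OF D] by (simp add: cong_mod_def)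
next
  case (Suc n)
  let ?d = "commutator G x g" and ?e = "commutator G (x [^] n) g"
  have 1: "cong_mod G D (?d [^] n \<otimes> ?d) (?e \<otimes> ?d)"
  proof -
    have "inv (?d [^] n \<otimes> ?d) \<otimes> (?e \<otimes> ?d) = inv ?d \<otimes> (inv (?d [^] n) \<otimes> ?e) \<otimes> ?d"
      using c by (simp add: m_assoc inv_mult_group)
    then show ?thesis using normal_conj(2)[OF D Suc[unfolded cong_mod_def], of ?d] c
      by (simp add: cong_mod_def)
  qed
  have Cn: "centralizer_mod G D (carrier G) \<lhd> G"
    by (rule normal_centralizer_mod_normal[OF D normal_carrier])
  have d: "?d [^] n \<in> centralizer_mod G D (carrier G)"
  proof -
    have "?d \<in> centralizer_mod G D (carrier G)" using central c by (simp add: centralizer_mod_def)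
    then show ?thesis by (induction n) (auto intro: normal_closed[OF Cn])
  qed
  have DC: "D \<subseteq> centralizer_mod G D (carrier G)"
    using normal_commutator_left[OF D] normal_closed(1)[OF D] by (auto simp: centralizer_mod_def)
  have "?e = ?d [^] n \<otimes> (inv (?d [^] n) \<otimes> ?e)" using c by (simp add: inv_cancel_left)
  then have "?e \<in> centralizer_mod G D (carrier G)"
    using normal_closed(3)[OF Cn d] Suc DC unfolding cong_mod_def by (metis subsetD)
  then have "commutator G ?e x \<in> D" using centralizer_modD(2) c by blast
  then have 2: "cong_mod G D (?e \<otimes> ?d) (commutator G (x [^] n \<otimes> x) g)"
    using c by (intro commutator_mult_left_mod[OF D]) auto
  show ?case using cong_mod_trans[OF D 1 2] c by simp
qed

text \<open>With \<open>e\<close> the order of the abelianization, a generator satisfies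
  \<open>[u,g]^e = [u^e,g]\<close> modulo the next term, and by induction \<open>u^e\<close> lies
  one term deeper than \<open>u\<close>. Elements whose \<open>e\<close>-th power lies in the next
  term form a subgroup \<open>S\<close>, because each section of the series is central.\<close>

lemma pow_lower_central:
  assumes "finite (carrier (abelianization G))" "x \<in> lower_central G k"
  shows "x [^] order (abelianization G) \<in> lower_central G (Suc k)"
  using assms(2)
proof (induction k arbitrary: x)
  case 0
  then show ?case using pow_order_abelianization[OF assms(1)] by simp
next
  case (Suc k)
  let ?e = "order (abelianization G)" and ?D = "lower_central G (Suc (Suc k))"
  note lc = normal_lower_central
  have D: "?D \<lhd> G" by (rule lc)
  have mod_mem: "y \<in> ?D" if "cong_mod G ?D x y" "x \<in> ?D" "y \<in> carrier G" for x y
  proof -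
    have "y = x \<otimes> (inv x \<otimes> y)" using that normal_closed(1)[OF D] by (simp add: inv_cancel_left)
    then show ?thesis using normal_closed(3)[OF D] that unfolding cong_mod_def by metis
  qed
  define S where "S = {z \<in> lower_central G (Suc k). z [^] ?e \<in> ?D}"
  have Sc: "z \<in> carrier G" if "z \<in> S" for z using that normal_closed(1)[OF lc] by (auto simp: S_def)
  have "subgroup S G"
  proof (rule subgroupI)
    show "S \<subseteq> carrier G" using Sc by blast
    show "S \<noteq> {}" using normal_closed(2)[OF lc] by (auto simp: S_def intro!: exI[of _ \<one>])
    show "inv z \<in> S" if z: "z \<in> S" for z
      using z Sc[OF z] normal_closed(4)[OF lc] by (simp add: S_def nat_pow_inv)
    show "z \<otimes> w \<in> S" if z: "z \<in> S" and w: "w \<in> S" for z w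
    proof -
      have zw: "z \<in> lower_central G (Suc k)" "w \<in> lower_central G (Suc k)" using z w by (auto simp: S_def)
      have "cong_mod G ?D (z [^] ?e \<otimes> w [^] ?e) ((z \<otimes> w) [^] ?e)"
        by (rule pow_mult_mod[OF D Sc[OF z] Sc[OF w] commutator_in_lower_central[OF zw(1)]])
      moreover have "z [^] ?e \<otimes> w [^] ?e \<in> ?D" using z w normal_closed(3)[OF D] unfolding S_def by blast
      ultimately have "(z \<otimes> w) [^] ?e \<in> ?D" using mod_mem Sc[OF z] Sc[OF w] by simp
      then show ?thesis using normal_closed(3)[OF lc zw] unfolding S_def by blast
    qed
  qed
  then have "commutator_subgroup G (lower_central G k) (carrier G) \<subseteq> S"
  proof (rule commutator_subgroup_leI)
    fix u g assume u: "u \<in> lower_central G k" and g: "g \<in> carrier G"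
    have uc: "u \<in> carrier G" using normal_closed(1)[OF lc u] .
    have ug: "commutator G u g \<in> lower_central G (Suc k)" by (rule commutator_in_lower_central[OF u g])
    have "inv (commutator G u g [^] ?e) \<otimes> commutator G (u [^] ?e) g \<in> ?D"
      using commutator_pow_mod[OF D uc g commutator_in_lower_central[OF ug]] by (simp add: cong_mod_def)
    moreover have "commutator G (u [^] ?e) g \<in> ?D"
      by (rule commutator_in_lower_central[OF Suc.IH[OF u] g])
    ultimately have "commutator G (u [^] ?e) g \<otimes> inv (inv (commutator G u g [^] ?e) \<otimes> commutator G (u [^] ?e) g) \<in> ?D"
      using normal_closed(3,4)[OF D] by blast
    then have "commutator G u g [^] ?e \<in> ?D"
      using uc g by (simp add: inv_mult_group inv_cancel_left m_assoc[symmetric])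
    then show "commutator G u g \<in> S" using ug by (simp add: S_def)
  qed
  then show ?case using Suc.prems unfolding S_def lower_central_Suc[of G k, symmetric] by blast
qed

text \<open>Each factor of the exponent moves the power one term down the series, and
  \<open>c\<close> factors reach the trivial term. This turns coprime abelianizations into coprime
  exponents.\<close>

lemma pow_eq_one_of_nilpotent:
  assumes "nilpotent_class_le G c" "finite (carrier (abelianization G))" "x \<in> carrier G"
  shows "x [^] (order (abelianization G) ^ c) = \<one>"
proof -
  have "x [^] (order (abelianization G) ^ k) \<in> lower_central G k" for k
  proof (induction k)
    case (Suc k)
    have "x [^] (order (abelianization G) ^ Suc k) = (x [^] (order (abelianization G) ^ k)) [^] order (abelianization G)"
      using assms(3) by (simp add: nat_pow_pow mult.commute)
    then show ?case using pow_lower_central[OF assms(2) Suc] by (simp)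
  qed (use assms(3) in simp)
  from this[of c] show ?thesis using assms(1) by (simp add: nilpotent_class_le_def)
qed

end

text \<open>The preimage of a term is a subgroup, so it suffices to inspect the generating
  commutators.\<close>

lemma (in group_hom) lower_central_hom:
  "h ` lower_central G k \<subseteq> lower_central H k"
proof (induction k)
  case (Suc k)
  have "commutator_subgroup G (lower_central G k) (carrier G)
    \<subseteq> {x \<in> carrier G. h x \<in> lower_central H (Suc k)}"
  proof (rule G.commutator_subgroup_leI)
    show "subgroup {x \<in> carrier G. h x \<in> lower_central H (Suc k)} G"
      by (intro subgroup_vimage normal_imp_subgroup H.normal_lower_central)
    fix x y assume x: "x \<in> lower_central G k" and y: "y \<in> carrier G"
    have xc: "x \<in> carrier G" using G.normal_closed(1)[OF G.normal_lower_central x] .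
    have "h x \<in> lower_central H k" using Suc x by blast
    then have "commutator H (h x) (h y) \<in> lower_central H (Suc k)"
      using y by (intro H.commutator_in_lower_central) auto
    then show "commutator G x y \<in> {x \<in> carrier G. h x \<in> lower_central H (Suc k)}"
      using xc y by (simp add: commutator_hom)
  qed
  then show ?case unfolding lower_central_Suc by blast
qed auto

lemma nilpotent_class_le_inj_hom:
  assumes "group_hom G H h" "inj_on h (carrier G)" "nilpotent_class_le H c"
  shows "nilpotent_class_le G c"
proof -
  interpret group_hom G H h by fact
  have "h ` lower_central G c \<subseteq> {\<one>\<^bsub>H\<^esub>}" using lower_central_hom[of c] assms(3) by (simp add: nilpotent_class_le_def)
  moreover have "lower_central G c \<subseteq> carrier G" using G.normal_closed(1)[OF G.normal_lower_central] by blast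
  ultimately have "x = \<one>\<^bsub>G\<^esub>" if "x \<in> lower_central G c" for x
    using inj_onD[OF assms(2), of x "\<one>\<^bsub>G\<^esub>"] that by auto
  then show ?thesis using G.normal_closed(2)[OF G.normal_lower_central, of c] unfolding nilpotent_class_le_def by blast
qed

section \<open>Polynilpotent words\<close>

lemma wrename_tree_word: "wrename f (tree_word t) = tree_word (map_comm_tree f t)"
  by (induction t) (simp_all add: wcomm_def)

lemma disjoint_leaves_map:
  assumes "inj f"
  shows "disjoint_leaves (map_comm_tree f t) = disjoint_leaves t"
proof (induction t)
  case (Comm l r)
  have "f ` leaves l \<inter> f ` leaves r = {} \<longleftrightarrow> leaves l \<inter> leaves r = {}"
    using image_Int[OF assms, of "leaves l" "leaves r"] by (metis image_is_empty)
  then show ?case using Comm by (simp add: comm_tree.set_map)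
qed simp

lemma lnwcomm_snoc: "ws \<noteq> [] \<Longrightarrow> lnwcomm (ws @ [w]) = wcomm (lnwcomm ws) w"
  by (cases ws) auto

text \<open>The inclusion for the leaves is the invariant of the induction: the next copy has head
  \<open>Suc c\<close> and is therefore disjoint from the bracket built so far.\<close>

lemma lnwcomm_tree_word:
  assumes "disjoint_leaves t"
  shows "\<exists>T. lnwcomm (map (\<lambda>j. wrename (Cons j) (tree_word t)) [0..<Suc c]) = tree_word T \<and>
    disjoint_leaves T \<and> leaves T \<subseteq> {j # v | j v. j < Suc c}"
proof (induction c)
  case 0
  show ?case
    by (rule exI[of _ "map_comm_tree (Cons 0) t"])
      (use assms in \<open>auto simp: wrename_tree_word disjoint_leaves_map comm_tree.set_map\<close>)
next
  case (Suc c)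
  let ?f = "\<lambda>j. wrename (Cons j) (tree_word t)"
  obtain T where T: "lnwcomm (map ?f [0..<Suc c]) = tree_word T"
    "disjoint_leaves T" "leaves T \<subseteq> {j # v | j v. j < Suc c}" using Suc by blast
  have e: "map ?f [0..<Suc (Suc c)] = map ?f [0..<Suc c] @ [?f (Suc c)]" by simp
  have ne: "map ?f [0..<Suc c] \<noteq> []" by simp
  have "lnwcomm (map ?f [0..<Suc (Suc c)]) = wcomm (tree_word T) (?f (Suc c))"
    unfolding e lnwcomm_snoc[OF ne] T(1) ..
  then have "lnwcomm (map ?f [0..<Suc (Suc c)]) = tree_word (Comm T (map_comm_tree (Cons (Suc c)) t))"
    by (simp add: wrename_tree_word)
  moreover have "disjoint_leaves (Comm T (map_comm_tree (Cons (Suc c)) t))"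
    using T assms by (auto simp: disjoint_leaves_map comm_tree.set_map)
  moreover have "leaves (Comm T (map_comm_tree (Cons (Suc c)) t)) \<subseteq> {j # v | j v. j < Suc (Suc c)}"
    using T(3) by (fastforce simp: comm_tree.set_map)
  ultimately show ?case by blast
qed

lemma polynilpotent_word_tree_word:
  "\<exists>t. polynilpotent_word cs = tree_word t \<and> disjoint_leaves t"
\<comment> \<open>The fold treats the last class last, as the outermost bracket, so the row is taken
  apart from the right.\<close>
proof (induction cs rule: rev_induct)
  case Nil
  show ?case by (rule exI[of _ "Leaf []"]) (simp add: polynilpotent_word_def)
next
  case (snoc c cs)
  then obtain t where "polynilpotent_word cs = tree_word t" "disjoint_leaves t" by blast
  moreover have "polynilpotent_word (cs @ [c]) =
      lnwcomm (map (\<lambda>j. wrename (Cons j) (polynilpotent_word cs)) [0..<Suc c])"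
    by (simp add: polynilpotent_word_def del: upt_Suc)
  ultimately show ?case using lnwcomm_tree_word[of t c] by metis
qed

section \<open>Capability of direct products\<close>

text \<open>Capability is restated as a surjection with marginal kernel, a form that passes to
  products and to subgroups without handling cosets.\<close>

lemma capableE_epi:
  fixes G :: "('a, 'b) monoid_scheme"
  assumes "group G" "capable V G"
  obtains E :: "'a list monoid" and \<phi> where "group_hom E G \<phi>" "\<phi> ` carrier E = carrier G"
    "kernel E G \<phi> = marginal V E"
proof -
  obtain E :: "'a list monoid" where E: "group E" "G \<cong> E Mod marginal V E"
    using assms(2) by (auto simp: capable_def)
  let ?M = "marginal V E"
  interpret G: group G by fact
  interpret E: group E by fact
  interpret M: normal ?M E by (rule marginal_normal) fact
  interpret Q: group "E Mod ?M" by (rule M.factorgroup_is_group)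
  obtain \<theta> where \<theta>: "\<theta> \<in> iso (E Mod ?M) G"
    using E(2) G.iso_sym unfolding is_iso_def by blast
  have \<theta>h: "\<theta> \<in> hom (E Mod ?M) G" and inj: "inj_on \<theta> (carrier (E Mod ?M))"
    and img: "\<theta> ` carrier (E Mod ?M) = carrier G"
    using \<theta> by (auto simp: iso_def bij_betw_def)
  have h: "\<theta> \<circ> (#>\<^bsub>E\<^esub>) ?M \<in> hom E G" by (rule hom_compose[OF M.r_coset_hom_Mod \<theta>h])
  have \<theta>1: "\<theta> ?M = \<one>\<^bsub>G\<^esub>" using hom_one[OF \<theta>h Q.is_group G.is_group] by simp
  have ker: "\<theta> (?M #>\<^bsub>E\<^esub> x) = \<one>\<^bsub>G\<^esub> \<longleftrightarrow> x \<in> ?M" if x: "x \<in> carrier E" for x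
  proof -
    have "\<theta> (?M #>\<^bsub>E\<^esub> x) = \<one>\<^bsub>G\<^esub> \<longleftrightarrow> ?M #>\<^bsub>E\<^esub> x = ?M"
      using inj_on_eq_iff[OF inj, of "?M #>\<^bsub>E\<^esub> x" ?M] x Q.one_closed \<theta>1 by (auto simp: carrier_FactGroup)
    then show ?thesis
      using E.coset_join1[OF _ x M.subgroup_axioms] E.coset_join2[OF x M.subgroup_axioms] by blast
  qed
  have "?M \<subseteq> carrier E" by (rule M.subset)
  show ?thesis
  proof (rule that[of E "\<theta> \<circ> (#>\<^bsub>E\<^esub>) ?M"])
    show "group_hom E G (\<theta> \<circ> (#>\<^bsub>E\<^esub>) ?M)"
      using h G.is_group E.is_group by (simp add: group_hom_def group_hom_axioms_def)
    show "(\<theta> \<circ> (#>\<^bsub>E\<^esub>) ?M) ` carrier E = carrier G"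
      using img by (simp add: carrier_FactGroup image_image)
    show "kernel E G (\<theta> \<circ> (#>\<^bsub>E\<^esub>) ?M) = ?M"
      using ker \<open>?M \<subseteq> carrier E\<close> by (auto simp: kernel_def)
  qed
qed

lemma capableI_epi:
  fixes V :: "('v :: countable) gword set"
  assumes "group_hom E G \<phi>" "\<phi> ` carrier E = carrier G" "kernel E G \<phi> = marginal V E"
  shows "capable V G"
proof -
  interpret group_hom E G \<phi> by fact
  have "E Mod marginal V E \<cong> G" using FactGroup_iso[OF assms(2)] unfolding assms(3) .
  then have "G \<cong> E Mod marginal V E"
    using group.iso_sym[OF normal.factorgroup_is_group[OF marginal_normal[OF G.is_group]]] by blast
  then show ?thesis using capableI[OF H.is_group G.is_group] by blast
qed

section \<open>Marginal subgroups and capability of direct products\<close>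

lemma product_group_proj:
  assumes "\<And>i. i \<in> I \<Longrightarrow> group (A i)" "i \<in> I"
  shows "group_hom (product_group I A) (A i) (\<lambda>f. f i)"
  using assms product_group[of I A] by (auto simp: group_hom_def group_hom_axioms_def hom_def PiE_iff)

lemma weval_product_group:
  assumes "\<And>i. i \<in> I \<Longrightarrow> group (A i)" "i \<in> I" "\<And>j. \<rho> j \<in> carrier (product_group I A)"
  shows "weval (product_group I A) \<rho> w i = weval (A i) (\<lambda>j. \<rho> j i) w"
proof -
  have "group_hom (product_group I A) (A i) (\<lambda>f. f i)"
    by (rule product_group_proj) (use assms in auto)
  from weval_hom[OF this, of \<rho> w] show ?thesis
    using assms(3) by (simp add: comp_def Pi_iff del: carrier_product_group)
qed

lemma marginal_product_group:
  fixes A :: "'i \<Rightarrow> ('a, 'b) monoid_scheme" and V :: "'v gword set"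
  assumes A: "\<And>i. i \<in> I \<Longrightarrow> group (A i)"
  shows "marginal V (product_group I A) = (\<Pi>\<^sub>E i\<in>I. marginal V (A i))"
proof (intro equalityI subsetI)
  let ?G = "product_group I A"
  have W: "weval ?G \<rho> w i = weval (A i) (\<lambda>j. \<rho> j i) w"
    if "i \<in> I" "\<And>j. \<rho> j \<in> carrier ?G" for \<rho> :: "'v \<Rightarrow> 'i \<Rightarrow> 'a" and w i
    by (rule weval_product_group) (use A that in auto)
  interpret G: group ?G using A by simp
  fix a assume a: "a \<in> marginal V ?G"
  then have ac: "a \<in> carrier ?G" by (simp add: marginal_def)
  show "a \<in> (\<Pi>\<^sub>E i\<in>I. marginal V (A i))"
  proof (rule PiE_I)
    fix i assume i: "i \<in> I"
    show "a i \<in> marginal V (A i)"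
    proof (rule marginalI)
      show "a i \<in> carrier (A i)" using ac i by auto
      fix v and \<rho> :: "'v \<Rightarrow> 'a" and k assume v: "v \<in> V" and \<rho>: "\<And>j. \<rho> j \<in> carrier (A i)"
      \<comment> \<open>The assignment in the factor is extended trivially to the other coordinates;
        coordinate \<open>i\<close> of the marginal law in the product is then the law in
        \<open>A i\<close>.\<close>
      define \<sigma> where "\<sigma> = (\<lambda>j. \<lambda>l\<in>I. if l = i then \<rho> j else \<one>\<^bsub>A l\<^esub>)"
      have \<sigma>: "\<sigma> j \<in> carrier ?G" for j
        using \<rho> group.is_monoid[OF A] by (auto simp: \<sigma>_def monoid.one_closed)
      let ?\<tau> = "\<sigma>(k := \<sigma> k \<otimes>\<^bsub>?G\<^esub> a)"
      have \<tau>: "?\<tau> j \<in> carrier ?G" for j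
        using G.m_closed[OF \<sigma> ac] \<sigma> by (simp del: mult_product_group carrier_product_group)
      have "weval (A i) (\<lambda>j. ?\<tau> j i) v = weval (A i) (\<lambda>j. \<sigma> j i) v"
        using marginalD[where \<rho> = \<sigma> and i = k, OF a v \<sigma>]
        unfolding W[where \<rho> = ?\<tau>, OF i \<tau>, symmetric] W[where \<rho> = \<sigma>, OF i \<sigma>, symmetric] by simp
      moreover have "(\<lambda>j. ?\<tau> j i) = \<rho>(k := \<rho> k \<otimes>\<^bsub>A i\<^esub> a i)" "(\<lambda>j. \<sigma> j i) = \<rho>"
        using i by (auto simp: \<sigma>_def)
      ultimately show "weval (A i) (\<rho>(k := \<rho> k \<otimes>\<^bsub>A i\<^esub> a i)) v = weval (A i) \<rho> v" by simp
    qed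
  qed (use ac in auto)
next
  let ?G = "product_group I A"
  have W: "weval ?G \<rho> w i = weval (A i) (\<lambda>j. \<rho> j i) w"
    if "i \<in> I" "\<And>j. \<rho> j \<in> carrier ?G" for \<rho> :: "'v \<Rightarrow> 'i \<Rightarrow> 'a" and w i
    by (rule weval_product_group) (use A that in auto)
  interpret G: group ?G using A by simp
  fix a assume a: "a \<in> (\<Pi>\<^sub>E i\<in>I. marginal V (A i))"
  then have ai: "a i \<in> marginal V (A i)" if "i \<in> I" for i using that by auto
  then have ac: "a \<in> carrier ?G" using a by (auto simp: marginal_def PiE_iff)
  show "a \<in> marginal V ?G"
  proof (rule marginalI[OF ac])
    fix v and \<rho> :: "'v \<Rightarrow> 'i \<Rightarrow> 'a" and k assume v: "v \<in> V" and \<rho>: "\<And>j. \<rho> j \<in> carrier ?G"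
    let ?\<tau> = "\<rho>(k := \<rho> k \<otimes>\<^bsub>?G\<^esub> a)"
    have \<tau>: "?\<tau> j \<in> carrier ?G" for j
      using G.m_closed[OF \<rho> ac] \<rho> by (simp del: mult_product_group carrier_product_group)
    have "weval ?G ?\<tau> v \<in> carrier ?G" "weval ?G \<rho> v \<in> carrier ?G"
      using weval_closed[OF G.is_group, of ?\<tau> v] weval_closed[OF G.is_group, of \<rho> v] \<tau> \<rho>
      by (auto simp del: mult_product_group carrier_product_group)
    moreover have "weval ?G ?\<tau> v i = weval ?G \<rho> v i" if i: "i \<in> I" for i
    proof -
      have "(\<lambda>j. ?\<tau> j i) = (\<lambda>j. \<rho> j i)(k := \<rho> k i \<otimes>\<^bsub>A i\<^esub> a i)" using i by auto
      moreover have "\<rho> j i \<in> carrier (A i)" for j using \<rho>[of j] i by auto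
      ultimately show ?thesis
        using marginalD[where \<rho> = "\<lambda>j. \<rho> j i" and i = k, OF ai[OF i] v]
        unfolding W[where \<rho> = ?\<tau>, OF i \<tau>] W[where \<rho> = \<rho>, OF i \<rho>] by simp
    qed
    ultimately show "weval ?G ?\<tau> v = weval ?G \<rho> v"
      by (simp only: carrier_product_group) (rule PiE_ext)
  qed
qed

text \<open>The product of the epimorphisms works, since both its kernel and the marginal subgroup
  of its domain are computed coordinatewise.\<close>

lemma capable_product_group:
  fixes A :: "'i \<Rightarrow> ('a, 'b) monoid_scheme" and V :: "('v :: countable) gword set"
  assumes A: "\<And>i. i \<in> I \<Longrightarrow> group (A i)" "\<And>i. i \<in> I \<Longrightarrow> capable V (A i)"
  shows "capable V (product_group I A)"
proof -
  have "\<forall>i\<in>I. \<exists>E :: 'a list monoid. \<exists>\<phi>. group_hom E (A i) \<phi> \<and> \<phi> ` carrier E = carrier (A i) \<and>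
    kernel E (A i) \<phi> = marginal V E"
    using capableE_epi[OF A] by metis
  then obtain E :: "'i \<Rightarrow> 'a list monoid" and \<phi> where E: "\<And>i. i \<in> I \<Longrightarrow> group_hom (E i) (A i) (\<phi> i)"
    "\<And>i. i \<in> I \<Longrightarrow> \<phi> i ` carrier (E i) = carrier (A i)"
    "\<And>i. i \<in> I \<Longrightarrow> kernel (E i) (A i) (\<phi> i) = marginal V (E i)"
    by metis
  have Eg: "group (E i)" if "i \<in> I" for i using E(1)[OF that] by (simp add: group_hom_def)
  define \<Phi> where "\<Phi> = (\<lambda>f. \<lambda>i\<in>I. \<phi> i (f i))"
  have hom: "\<phi> i \<in> hom (E i) (A i)" if "i \<in> I" for i
    using E(1)[OF that] by (simp add: group_hom_def group_hom_axioms_def)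
  show ?thesis
  proof (rule capableI_epi)
    have "\<Phi> \<in> hom (product_group I E) (product_group I A)"
    proof (rule homI)
      show "\<Phi> x \<in> carrier (product_group I A)" if "x \<in> carrier (product_group I E)" for x
        using that by (auto simp: \<Phi>_def intro!: hom_in_carrier[OF hom])
      show "\<Phi> (x \<otimes>\<^bsub>product_group I E\<^esub> y) = \<Phi> x \<otimes>\<^bsub>product_group I A\<^esub> \<Phi> y"
        if "x \<in> carrier (product_group I E)" "y \<in> carrier (product_group I E)" for x y
        using that by (auto simp: \<Phi>_def restrict_def fun_eq_iff intro!: hom_mult[OF hom])
    qed
    then show "group_hom (product_group I E) (product_group I A) \<Phi>"
      using A(1) Eg by (simp add: group_hom_def group_hom_axioms_def)
    show "\<Phi> ` carrier (product_group I E) = carrier (product_group I A)"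
    proof
      show "\<Phi> ` carrier (product_group I E) \<subseteq> carrier (product_group I A)"
        by (auto simp: \<Phi>_def intro!: hom_in_carrier[OF hom])
      show "carrier (product_group I A) \<subseteq> \<Phi> ` carrier (product_group I E)"
      proof
        fix g assume g: "g \<in> carrier (product_group I A)"
        have "\<forall>i\<in>I. \<exists>x\<in>carrier (E i). \<phi> i x = g i"
        proof
          fix i assume i: "i \<in> I"
          then have "g i \<in> \<phi> i ` carrier (E i)" using g E(2)[OF i] by auto
          then show "\<exists>x\<in>carrier (E i). \<phi> i x = g i" by force
        qed
        then obtain f where f: "\<And>i. i \<in> I \<Longrightarrow> f i \<in> carrier (E i) \<and> \<phi> i (f i) = g i" by metis
        have "\<Phi> (restrict f I) = g" using f g by (auto simp: \<Phi>_def fun_eq_iff PiE_iff extensional_def)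
        moreover have "restrict f I \<in> carrier (product_group I E)" using f by auto
        ultimately show "g \<in> \<Phi> ` carrier (product_group I E)" by blast
      qed
    qed
    have "kernel (product_group I E) (product_group I A) \<Phi> = (\<Pi>\<^sub>E i\<in>I. kernel (E i) (A i) (\<phi> i))"
      by (auto simp: kernel_def \<Phi>_def PiE_iff restrict_def fun_eq_iff extensional_def)
    also have "\<dots> = (\<Pi>\<^sub>E i\<in>I. marginal V (E i))" by (rule PiE_cong) (rule E(3))
    also have "\<dots> = marginal V (product_group I E)"
      by (rule marginal_product_group[symmetric]) (rule Eg)
    finally show "kernel (product_group I E) (product_group I A) \<Phi> = marginal V (product_group I E)" .
  qed
qed

text \<open>The witness for \<open>A i\<close> is the preimage \<open>P\<close> of this factor
  inside a witness \<open>E\<close> for the product. Coordinate \<open>i\<close> maps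
  \<open>P\<close> onto \<open>A i\<close> with kernel the marginal subgroup of \<open>E\<close>,
  which \<open>marginal_factor\<close> identifies with that of \<open>P\<close>.\<close>

lemma capable_factor_of_product_group:
  fixes A :: "'i \<Rightarrow> ('a, 'b) monoid_scheme" and t :: "('v :: countable) comm_tree"
  assumes t: "disjoint_leaves t" and I: "finite I" and A: "\<And>i. i \<in> I \<Longrightarrow> group (A i)"
    and cop: "mutually_coprime_abelianizations I A"
    and nil: "nilpotent_class_le (product_group I A) c"
    and cap: "capable {tree_word t} (product_group I A)"
    and i: "i \<in> I"
  shows "capable {tree_word t} (A i)"
proof -
  let ?G = "product_group I A" and ?M = "\<lambda>E. marginal {tree_word t} E"
  have G: "group ?G" using A by simp
  obtain E :: "('i \<Rightarrow> 'a) list monoid" and \<phi> where \<phi>: "group_hom E ?G \<phi>" "\<phi> ` carrier E = carrier ?G"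
    "kernel E ?G \<phi> = ?M E"
    using capableE_epi[OF G cap] by metis
  interpret group_hom E ?G \<phi> by fact
  have Ai: "group_hom E (A j) (\<lambda>e. \<phi> e j)" if "j \<in> I" for j
  proof -
    have "group_hom ?G (A j) (\<lambda>f. f j)" by (rule product_group_proj) (use A that in auto)
    from Group.hom_compose[OF homh group_hom.homh[OF this]] show ?thesis
      using A[OF that] G.is_group by (simp add: comp_def group_hom_def group_hom_axioms_def)
  qed
  have M: "x \<in> ?M E \<longleftrightarrow> x \<in> carrier E \<and> (\<forall>j\<in>I. \<phi> x j = \<one>\<^bsub>A j\<^esub>)" for x
  proof (cases "x \<in> carrier E")
    case True
    then have c: "\<phi> x \<in> carrier ?G" by (rule hom_closed)
    have "\<phi> x = \<one>\<^bsub>?G\<^esub> \<longleftrightarrow> (\<forall>j\<in>I. \<phi> x j = \<one>\<^bsub>A j\<^esub>)"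
    proof
      assume "\<forall>j\<in>I. \<phi> x j = \<one>\<^bsub>A j\<^esub>"
      then show "\<phi> x = \<one>\<^bsub>?G\<^esub>" using c by (intro extensionalityI[of _ I]) (auto simp: PiE_iff)
    qed simp
    then show ?thesis using True \<phi>(3)[symmetric] by (simp add: kernel_def)
  qed (use \<phi>(3)[symmetric] in \<open>simp add: kernel_def\<close>)
  define N where "N = (\<lambda>J. {e \<in> carrier E. \<forall>j\<in>J. \<phi> e j = \<one>\<^bsub>A j\<^esub>})"
  have N: "N J \<lhd> E" if "J \<subseteq> I" for J
  proof (rule G.normalI_closed)
    note hom = group_hom.hom_mult[OF Ai] group_hom.hom_inv[OF Ai] group_hom.hom_one[OF Ai]
      group_hom.hom_closed[OF Ai]
    have Am: "monoid (A j)" "group (A j)" if "j \<in> I" for j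
      using A[OF that] group.is_monoid by auto
    have J: "j \<in> I" if "j \<in> J" for j using that \<open>J \<subseteq> I\<close> by blast
    show "N J \<subseteq> carrier E" by (auto simp: N_def)
    show "\<one>\<^bsub>E\<^esub> \<in> N J" using hom J by (simp add: N_def)
    show "x \<otimes>\<^bsub>E\<^esub> y \<in> N J" if "x \<in> N J" "y \<in> N J" for x y
      using that hom J Am by (simp add: N_def monoid.l_one monoid.one_closed)
    show "inv\<^bsub>E\<^esub> x \<in> N J" if "x \<in> N J" for x
      using that hom J Am by (simp add: N_def monoid.inv_one)
    show "g \<otimes>\<^bsub>E\<^esub> x \<otimes>\<^bsub>E\<^esub> inv\<^bsub>E\<^esub> g \<in> N J" if "x \<in> N J" "g \<in> carrier E" for x g
      using that hom J Am by (simp add: N_def monoid.r_one group.r_inv)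
  qed
  \<comment> \<open>\<open>P\<close> is the preimage of the factor \<open>A i\<close>, and
    \<open>Q\<close> that of the product of the other factors.\<close>
  define P where "P = N (I - {i})"
  define Q where "Q = N {i}"
  define o' where "o' = (\<lambda>j. order (abelianization (A j)) ^ c)"
  have nilA: "nilpotent_class_le (A j) c" if j: "j \<in> I" for j
  proof (rule nilpotent_class_le_inj_hom[OF _ _ nil])
    let ?\<iota> = "\<lambda>x. \<lambda>l\<in>I. if l = j then x else \<one>\<^bsub>A l\<^esub>"
    show "group_hom (A j) ?G ?\<iota>"
    proof -
      have one: "\<one>\<^bsub>A l\<^esub> \<in> carrier (A l)" "\<one>\<^bsub>A l\<^esub> \<otimes>\<^bsub>A l\<^esub> \<one>\<^bsub>A l\<^esub> = \<one>\<^bsub>A l\<^esub>" if "l \<in> I" for l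
        using group.is_monoid[OF A[OF that]] by (simp_all add: monoid.one_closed monoid.l_one)
      have "?\<iota> \<in> hom (A j) ?G"
        by (rule homI) (use one in \<open>auto simp: restrict_def fun_eq_iff\<close>)
      then show ?thesis using A[OF j] G by (simp add: group_hom_def group_hom_axioms_def)
    qed
    show "inj_on ?\<iota> (carrier (A j))"
    proof (rule inj_onI)
      fix x y assume "?\<iota> x = ?\<iota> y"
      from fun_cong[OF this, of j] show "x = y" using j by simp
    qed
  qed
  have pow: "\<phi> (e [^]\<^bsub>E\<^esub> n) j = \<phi> e j [^]\<^bsub>A j\<^esub> n" if "j \<in> I" "e \<in> carrier E" for e j and n :: nat
    using group_hom.hom_nat_pow[OF Ai[OF that(1)] that(2)] .
  have po: "\<phi> e j [^]\<^bsub>A j\<^esub> o' j = \<one>\<^bsub>A j\<^esub>" if "j \<in> I" "e \<in> carrier E" for e j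
    unfolding o'_def
    by (rule group.pow_eq_one_of_nilpotent[OF A nilA])
      (use that cop group_hom.hom_closed[OF Ai] in \<open>auto simp: mutually_coprime_abelianizations_def\<close>)
  have po_dvd: "\<phi> e j [^]\<^bsub>A j\<^esub> n = \<one>\<^bsub>A j\<^esub>" if "j \<in> I" "e \<in> carrier E" "o' j dvd n" for e j n
    using po[OF that(1,2)] that group.pow_eq_id[OF A[OF that(1)] group_hom.hom_closed[OF Ai[OF that(1)] that(2)]]
    by (metis dvd_trans)
  have one_pow: "\<one>\<^bsub>A j\<^esub> [^]\<^bsub>A j\<^esub> (n::nat) = \<one>\<^bsub>A j\<^esub>" if "j \<in> I" for j n
    using group.is_monoid[OF A[OF that]] by (rule monoid.nat_pow_one)
  \<comment> \<open>The pulled back lower central series of the product: it starts at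
    \<open>E\<close>, and nilpotency puts \<open>L c\<close> into the kernel of
    \<open>\<phi>\<close>, which is the marginal subgroup.\<close>
  define L where "L = (\<lambda>k. {e \<in> carrier E. \<phi> e \<in> lower_central ?G k})"
  have MP: "?M (E\<lparr>carrier := P\<rparr>) = ?M E"
  \<comment> \<open>Modulo the marginal subgroup only coordinate \<open>i\<close> survives on
    \<open>P\<close>, so \<open>o' i\<close> annihilates it; on \<open>Q\<close> the other
    coordinates survive, and the product of their exponents does.\<close>
  proof (rule G.marginal_factor[OF t, of L c P "o' i" Q "prod o' (I - {i})"])
    show "subgroup (L k) E" for k
      unfolding L_def by (intro subgroup_vimage normal_imp_subgroup H.normal_lower_central)
    show "commutator E u g \<in> L (Suc k)" if "u \<in> L k" "g \<in> carrier E" for k u g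
      using that H.commutator_in_lower_central[of "\<phi> u" k "\<phi> g"]
      by (simp add: L_def commutator_hom del: carrier_product_group)
    show "L 0 = carrier E" unfolding L_def lower_central.simps(1) using hom_closed by blast
    show "L c \<subseteq> ?M E"
      using nil unfolding L_def nilpotent_class_le_def \<phi>(3)[symmetric] kernel_def by blast
    show "x [^]\<^bsub>E\<^esub> o' i \<in> ?M E" if "x \<in> P" for x
    proof -
      have "\<phi> x j [^]\<^bsub>A j\<^esub> o' i = \<one>\<^bsub>A j\<^esub>" if j: "j \<in> I" for j
        by (cases "j = i") (use j po one_pow \<open>x \<in> P\<close> in \<open>auto simp: P_def N_def\<close>)
      then show ?thesis using that pow by (simp add: M P_def N_def)
    qed
    show "y [^]\<^bsub>E\<^esub> prod o' (I - {i}) \<in> ?M E" if "y \<in> Q" for y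
    proof -
      have "\<phi> y j [^]\<^bsub>A j\<^esub> prod o' (I - {i}) = \<one>\<^bsub>A j\<^esub>" if j: "j \<in> I" for j
      proof (cases "j = i")
        case True
        then show ?thesis using \<open>y \<in> Q\<close> j one_pow by (simp add: Q_def N_def)
      next
        case False
        then have "o' j dvd prod o' (I - {i})" using j I by (intro dvd_prodI) auto
        then show ?thesis using po_dvd j \<open>y \<in> Q\<close> by (simp add: Q_def N_def)
      qed
      then show ?thesis using that pow by (simp add: M Q_def N_def)
    qed
    show "coprime (o' i) (prod o' (I - {i}))"
      using cop i by (intro prod_coprime_right)
        (auto simp: o'_def mutually_coprime_abelianizations_def)
    show "P \<lhd> E" "Q \<lhd> E" using N i by (auto simp: P_def Q_def)
    show "?M E \<subseteq> P" by (auto simp: M P_def N_def)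
    show "P \<inter> Q \<subseteq> ?M E" by (auto simp: M P_def Q_def N_def)
    fix g assume g: "g \<in> carrier E"
    \<comment> \<open>\<open>f\<close> keeps only coordinate \<open>i\<close> of
      \<open>\<phi> g\<close>. A lift \<open>x\<close> of \<open>f\<close> lies in \<open>P\<close>,
      and the remaining factor \<open>inv x g\<close> is trivial at \<open>i\<close>.\<close>
    define f where "f = (\<lambda>j\<in>I. if j = i then \<phi> g j else \<one>\<^bsub>A j\<^esub>)"
    have "f \<in> carrier ?G"
      using group_hom.hom_closed[OF Ai[OF i] g] group.is_monoid[OF A] by (auto simp: f_def monoid.one_closed)
    then obtain x where x: "x \<in> carrier E" "\<phi> x = f" unfolding \<phi>(2)[symmetric] by blast
    have "x \<in> P" using x by (simp add: P_def N_def f_def)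
    moreover have "inv\<^bsub>E\<^esub> x \<otimes>\<^bsub>E\<^esub> g \<in> Q"
    proof -
      interpret h: group_hom E "A i" "\<lambda>e. \<phi> e i" by (rule Ai[OF i])
      have "\<phi> x i = \<phi> g i" using x i by (simp add: f_def)
      then show ?thesis using x g h.hom_mult[of "inv\<^bsub>E\<^esub> x" g] h.hom_inv[of x] by (simp add: Q_def N_def)
    qed
    moreover have "g = x \<otimes>\<^bsub>E\<^esub> (inv\<^bsub>E\<^esub> x \<otimes>\<^bsub>E\<^esub> g)" using x g by (simp add: G.inv_cancel_left)
    ultimately show "\<exists>x\<in>P. \<exists>y\<in>Q. g = x \<otimes>\<^bsub>E\<^esub> y" by blast
  qed
  have PE: "P \<lhd> E" using N by (auto simp: P_def)
  show ?thesis
  proof (rule capableI_epi)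
    have Pc: "x \<in> carrier E" if "x \<in> P" for x using that by (simp add: P_def N_def)
    have "group (E\<lparr>carrier := P\<rparr>)"
      using G.subgroup_imp_group[OF normal_imp_subgroup[OF PE]] .
    then show "group_hom (E\<lparr>carrier := P\<rparr>) (A i) (\<lambda>e. \<phi> e i)"
      using A i Pc group_hom.hom_mult[OF Ai[OF i]] group_hom.hom_closed[OF Ai[OF i]]
      by (auto simp: group_hom_def group_hom_axioms_def hom_def)
    show "(\<lambda>e. \<phi> e i) ` carrier (E\<lparr>carrier := P\<rparr>) = carrier (A i)"
    proof
      show "(\<lambda>e. \<phi> e i) ` carrier (E\<lparr>carrier := P\<rparr>) \<subseteq> carrier (A i)"
        using Pc group_hom.hom_closed[OF Ai[OF i]] by auto
      show "carrier (A i) \<subseteq> (\<lambda>e. \<phi> e i) ` carrier (E\<lparr>carrier := P\<rparr>)"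
      proof
        fix z assume z: "z \<in> carrier (A i)"
        define f where "f = (\<lambda>j\<in>I. if j = i then z else \<one>\<^bsub>A j\<^esub>)"
        have "f \<in> carrier ?G"
          using z group.is_monoid[OF A] by (auto simp: f_def monoid.one_closed)
        then obtain x where x: "x \<in> carrier E" "\<phi> x = f" unfolding \<phi>(2)[symmetric] by blast
        have "x \<in> P" "\<phi> x i = z" using x i by (simp_all add: P_def N_def f_def)
        then show "z \<in> (\<lambda>e. \<phi> e i) ` carrier (E\<lparr>carrier := P\<rparr>)" by force
      qed
    qed
    show "kernel (E\<lparr>carrier := P\<rparr>) (A i) (\<lambda>e. \<phi> e i) = ?M (E\<lparr>carrier := P\<rparr>)"
      unfolding MP using M i by (auto simp: kernel_def P_def N_def)
  qed
qed

theorem corollary3p3: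
  fixes A :: "nat \<Rightarrow> 'a monoid" and n :: nat and cs :: "nat list"
  assumes "cs \<noteq> []" and "\<forall>c \<in> set cs. 1 \<le> c"
    and "\<And>i. i \<in> {1..n} \<Longrightarrow> group (A i)"
    and "mutually_coprime_abelianizations {1..n} A"
    and "nilpotent_class_le (product_group {1..n} A) (cs ! 0)"
  shows "capable {polynilpotent_word cs} (product_group {1..n} A) \<longleftrightarrow>
    (\<forall>i \<in> {1..n}. capable {polynilpotent_word cs} (A i))"
proof -
  obtain t where t: "polynilpotent_word cs = tree_word t" "disjoint_leaves t"
    using polynilpotent_word_tree_word by blast
  show ?thesis
    unfolding t(1)
  proof (intro iffI ballI)
    fix i assume "capable {tree_word t} (product_group {1..n} A)" and "i \<in> {1..n}"
    then show "capable {tree_word t} (A i)"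
      using capable_factor_of_product_group[OF t(2) _ _ assms(4,5)] assms(3) by simp
  next
    assume "\<forall>i\<in>{1..n}. capable {tree_word t} (A i)"
    then show "capable {tree_word t} (product_group {1..n} A)"
      by (intro capable_product_group assms(3)) auto
  qed
qed

end
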